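(* Let $t(x)=\sqrt{(1-2q)^2x^2-2x(1+2q)+1}$ (the formal power series with constant term $1$). Define $U^+(x,v,w)=\sum_{n\ge3}\sum_{i=1}^{n-2}\sum_{j=i+1}^{n-1}u_n(i,j)v^iw^jx^n$, $U^-(x,v,w)=\sum_{n\ge2}\sum_{i=2}^{n}\sum_{j=1}^{i-1}u_n(i,j)v^iw^jx^n$, $U^0(x,v)=\sum_{n\ge2}\sum_{i=1}^{n-1}u_n(i,i)v^ix^n$ and $U(x,v,w)=\sum_{n\ge2}\sum_{i=1}^{n}\sum_{j=1}^{n-1}u_n(i,j)v^iw^jx^n$. Then $U(x,v,w)=U^+(x,v,w)+U^-(x,v,w)+U^0(x,vw)$, where $$U^0(x,v)=\frac{vx^2\bigl(2(v-1)vqx-(v-3)vx-3v+1\bigr)+v(v+1)x^2t(vx)}{2(2vqx-vx+v+x-1)(vqx-vx-1)},$$ $$U^+(x,v,w)=-\frac{vw^2qx^2(vwqx-v+x)\,t(vwx)+vw^2qx^2\bigl((2vwq^2-vwq+1)vwx^2-(2v^2wq+vwq-v^2w+2vw+2v-1)x+v\bigr)}{2\,\Gamma\,(vw^2q^2x^2-vw^2qx^2-wqx+vwx-wx-v+1)},$$ and, with $\Gamma=2vwqx-vwx+vw+x-1$ and $\Delta=v^2wq^2x^2-v^2wqx^2-vqx+vwx-vx-w+1$, $$U^-(x,v,w)=\frac{v^2wqx^2(vwqx-vwx+vw+w-1)\,t(vwx)}{2\Gamma\Delta}+\frac{\bigl(-2v(q+1)x^2+(vq+2v+2)x-1\bigr)v^2wqx^2}{2\Delta(vqx-1)\Gamma}$$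 $$+\frac{\bigl(2v^2q(q-1)x^3-(3vq^2-2(v+1))vx^2-(v^2q-2vq+2(v+1)^2)x+v+1\bigr)v^2w^2qx^2}{2\Delta(vqx-1)\Gamma}+\frac{(2q-1)(vqx-1)(vqx-vx+v+1)v^3w^3qx^3}{2\Delta(vqx-1)\Gamma}.$$
   Context: $\mathcal{U}_n$ is the set of sequences $e=e_1\cdots e_n$ of integers with $1\le e_i\le i$ such that there are no indices $i<j<k$ with $e_i\ge e_j$ and $e_i>e_k$. $\mathrm{dist}(e)$ is the number of distinct values in $e$, $\mathrm{last}(e)=e_n$, and $\mathrm{hght}(e)=\max\{e_i:1\le i\le n-1,\ e_i\ge e_{i+1}\}$. For $n\ge2$, $1\le i\le n$, $1\le j\le n-1$, $u_n(i,j)=\sum q^{\mathrm{dist}(e)-1}$ over $e\in\mathcal{U}_n$ with $\mathrm{last}(e)=i$, $\mathrm{hght}(e)=j$. All identities are of formal power series in $x$. *)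

theory Defs
  imports "HOL-Computational_Algebra.Computational_Algebra"
begin

text \<open>The entry \<open>e\<^sub>i\<close> of a sequence is the list element \<open>e ! (i - 1)\<close>, so the bound
  \<open>1 \<le> e\<^sub>i \<le> i\<close> becomes \<open>1 \<le> e ! i \<le> i + 1\<close>.\<close>

definition useqs :: "nat \<Rightarrow> nat list set" where
  "useqs n = {e. length e = n \<and> (\<forall>i<n. 1 \<le> e ! i \<and> e ! i \<le> i + 1) \<and>
     \<not> (\<exists>i j k. i < j \<and> j < k \<and> k < n \<and> e ! i \<ge> e ! j \<and> e ! i > e ! k)}"

lemma finite_useqs: "finite (useqs n)"
proof (rule finite_subset)
  show "useqs n \<subseteq> {e. set e \<subseteq> {..n} \<and> length e = n}"
    by (fastforce simp: useqs_def in_set_conv_nth)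
  show "finite {e. set e \<subseteq> {..n} \<and> length e = n}"
    by (rule finite_lists_length_eq) simp
qed

definition dist_vals :: "nat list \<Rightarrow> nat" where
  "dist_vals e = card (set e)"

text \<open>The maximum is over the empty set exactly for strictly increasing sequences (in \<open>useqs n\<close>
  this is \<open>1, 2, \<dots>, n\<close> only). The value 0 chosen for them lies outside the range \<open>1 \<le> j\<close>
  in which the heights \<open>j\<close> are summed below, so these sequences are not counted.\<close>

definition hght :: "nat list \<Rightarrow> nat" where
  "hght e = (let H = {e ! i | i. i + 1 < length e \<and> e ! i \<ge> e ! (i + 1)}
             in if H = {} then 0 else Max H)"

definition u :: "'a::comm_semiring_1 \<Rightarrow> nat \<Rightarrow> nat \<Rightarrow> nat \<Rightarrow> 'a" where
  "u q n i j = (\<Sum>e\<in>{e \<in> useqs n. last e = i \<and> hght e = j}. q ^ (dist_vals e - 1))"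

text \<open>The generating functions are power series in \<open>x\<close> only; \<open>q\<close>, \<open>v\<close>, \<open>w\<close> are elements of the
  coefficient ring, later taken to be indeterminates.\<close>

definition U_plus :: "'a::comm_semiring_1 \<Rightarrow> 'a \<Rightarrow> 'a \<Rightarrow> 'a fps" where
  "U_plus q v w = Abs_fps (\<lambda>n. if 3 \<le> n
     then (\<Sum>i=1..n-2. \<Sum>j=i+1..n-1. u q n i j * v ^ i * w ^ j) else 0)"

definition U_minus :: "'a::comm_semiring_1 \<Rightarrow> 'a \<Rightarrow> 'a \<Rightarrow> 'a fps" where
  "U_minus q v w = Abs_fps (\<lambda>n. if 2 \<le> n
     then (\<Sum>i=2..n. \<Sum>j=1..i-1. u q n i j * v ^ i * w ^ j) else 0)"

definition U_zero :: "'a::comm_semiring_1 \<Rightarrow> 'a \<Rightarrow> 'a fps" where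
  "U_zero q v = Abs_fps (\<lambda>n. if 2 \<le> n
     then (\<Sum>i=1..n-1. u q n i i * v ^ i) else 0)"

definition U_full :: "'a::comm_semiring_1 \<Rightarrow> 'a \<Rightarrow> 'a \<Rightarrow> 'a fps" where
  "U_full q v w = Abs_fps (\<lambda>n. if 2 \<le> n
     then (\<Sum>i=1..n. \<Sum>j=1..n-1. u q n i j * v ^ i * w ^ j) else 0)"

text \<open>The first argument of \<open>fps_radical\<close> supplies the root of the constant coefficient; here that
  coefficient is 1 and the chosen root is 1.\<close>

definition t_radicand :: "'a::comm_ring_1 \<Rightarrow> 'a fps" where
  "t_radicand q = fps_const ((1 - 2 * q)\<^sup>2) * fps_X\<^sup>2 - 2 * fps_X * fps_const (1 + 2 * q) + 1"

definition t_series :: "'a::field_char_0 \<Rightarrow> 'a fps" where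
  "t_series q = fps_radical (\<lambda>_ _. 1) 2 (t_radicand q)"

lemma t_radicand_nth_0: "t_radicand q $ 0 = 1"
  by (simp add: t_radicand_def fps_mult_nth_0 power2_eq_square)

lemma t_series_nth_0: "t_series q $ 0 = 1"
  by (simp add: t_series_def)

lemma t_series_square: "(t_series q)\<^sup>2 = t_radicand q"
  using power_radical[of "t_radicand q" "\<lambda>_ _. 1" 1]
  by (simp add: t_series_def t_radicand_nth_0 numeral_2_eq_2)

text \<open>The coefficient field is the field of fractions of \<open>\<rat>[q][v][w]\<close>, and the three constants
  below are its generators.\<close>

type_synonym ratfun = "rat poly poly poly fract"

definition ind_q :: ratfun where "ind_q = Fract [:[:[:0, 1:]:]:] 1"
definition ind_v :: ratfun where "ind_v = Fract [:[:0, 1:]:] 1"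
definition ind_w :: ratfun where "ind_w = Fract [:0, 1:] 1"

text \<open>These elements are the constant coefficients (up to sign) of the denominators of the closed
  forms, other than those equal to a nonzero integer. They are nonzero, so every denominator is a
  unit and division of power series is multiplication by the inverse.\<close>

lemma ind_units: "ind_v - 1 \<noteq> 0" "ind_w - 1 \<noteq> 0" "ind_v * ind_w - 1 \<noteq> 0"
  by (simp_all add: ind_v_def ind_w_def One_fract_def Zero_fract_def eq_fract one_pCons)

end

theory Submission
  imports Defs
begin

text \<open>An entry \<open>c\<close> may be appended to a sequence \<open>e\<close> of \<open>useqs n\<close> iff \<open>hght e \<le> c \<le> n + 1\<close>,
  and \<open>max (last e) (hght e)\<close> is the maximal value of \<open>e\<close>. Let \<open>b\<^sub>n(j)\<close> sum \<open>q\<close> to the number of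
  distinct values over the sequences with maximum \<open>j\<close>. The sequences with \<open>last < hght = j\<close> and those
  with \<open>hght < last = j\<close> turn out to have the same weight, which gives \<open>b\<^sub>n\<^sub>+\<^sub>1(j) = b\<^sub>n(j) + 2q (\<Sum>l<j. b\<^sub>n(l))\<close> for \<open>1 \<le> j \<le> n\<close>, while
  \<open>b\<^sub>n\<^sub>+\<^sub>1(n + 1) = q (\<Sum>l. b\<^sub>n(l))\<close>. Since the number \<open>n - j\<close> grows by at most one per step, the solution
  is geometric: \<open>b\<^sub>n(j)\<close> is \<open>q\<close> times the coefficient of \<open>z\<^sup>j\<^sup>-\<^sup>1\<close> in \<open>\<beta>(z) h(z)\<^sup>n\<^sup>-\<^sup>j\<close>, where
  \<open>\<beta>\<close> counts all sequences and \<open>h = 1 + z (h\<^sup>2 - h + 2 q h)\<close>. In the same way \<open>u\<^sub>n(i,j)\<close> is a coefficient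
  of a power of \<open>h\<close> times a power of \<open>h + q\<close>, so that the three generating functions are products of
  geometric series evaluated at \<open>z = v w x\<close>. The closed forms follow by eliminating \<open>1/h\<close>, which is
  \<open>(1 + z - 2 q z + t(z)) / 2\<close>.\<close>

section \<open>Appending an entry\<close>

definition last0 :: "nat list \<Rightarrow> nat" where
  "last0 e = (if e = [] then 0 else last e)"

definition max_val :: "nat list \<Rightarrow> nat" where
  "max_val e = Max (insert 0 (set e))"

lemma last0_snoc [simp]: "last0 (e @ [c]) = c"
  by (simp add: last0_def)

lemma max_val_le_iff: "max_val e \<le> c \<longleftrightarrow> (\<forall>x\<in>set e. x \<le> c)"
  by (simp add: max_val_def)

lemma nat_eq_by_le: "(\<And>c. x \<le> c \<longleftrightarrow> y \<le> c) \<Longrightarrow> x = (y::nat)"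
  by (meson antisym order_refl)

lemma max_val_snoc: "max_val (e @ [c]) = max (max_val e) c"
  by (rule nat_eq_by_le) (auto simp: max_val_le_iff)

lemma max_val_in_set: "max_val e \<noteq> 0 \<Longrightarrow> max_val e \<in> set e"
  unfolding max_val_def using Max_in[of "insert 0 (set e)"] by auto

lemma not_in_set_above_max_val: "max_val e < c \<Longrightarrow> c \<notin> set e"
  using max_val_le_iff[of e "max_val e"] by auto

lemma hght_le_iff:
  "hght e \<le> c \<longleftrightarrow> (\<forall>i. i + 1 < length e \<longrightarrow> e ! i \<ge> e ! (i + 1) \<longrightarrow> e ! i \<le> c)"
proof -
  define H where "H = {e ! i | i. i + 1 < length e \<and> e ! i \<ge> e ! (i + 1)}"
  have "finite H"
    by (rule finite_subset[of _ "(!) e ` {..<length e}"]) (auto simp: H_def)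
  moreover have "hght e = (if H = {} then 0 else Max H)"
    unfolding hght_def Let_def H_def by (rule refl)
  ultimately have "hght e \<le> c \<longleftrightarrow> (\<forall>x\<in>H. x \<le> c)"
    by auto
  then show ?thesis
    by (auto simp: H_def)
qed

lemma hght_Nil [simp]: "hght [] = 0"
  by (simp add: hght_def)

text \<open>Appending \<open>c\<close> adds one adjacent pair, so the only new candidate for the
  height is \<open>last e\<close>, and it counts exactly when \<open>c \<le> last e\<close>.\<close>

lemma hght_snoc_max:
  "hght (e @ [c]) = (if e \<noteq> [] \<and> c \<le> last e then max (hght e) (last e) else hght e)"
proof (rule nat_eq_by_le)
  fix m
  have "hght (e @ [c]) \<le> m \<longleftrightarrow> hght e \<le> m \<and> (e \<noteq> [] \<and> c \<le> last e \<longrightarrow> last e \<le> m)"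
    (is "?L \<longleftrightarrow> ?R")
  proof
    assume L: ?L
    have "last e \<le> m" if "e \<noteq> []" "c \<le> last e"
      using L[unfolded hght_le_iff, rule_format, of "length e - 1"] that
      by (simp add: nth_append last_conv_nth)
    moreover have "hght e \<le> m"
      unfolding hght_le_iff
    proof (intro allI impI)
      fix i assume "i + 1 < length e" "e ! i \<ge> e ! (i + 1)"
      then show "e ! i \<le> m"
        using L[unfolded hght_le_iff, rule_format, of i] by (simp add: nth_append)
    qed
    ultimately show ?R by blast
  next
    assume R: ?R
    show ?L
      unfolding hght_le_iff
    proof (intro allI impI)
      fix i assume i: "i + 1 < length (e @ [c])" "(e @ [c]) ! i \<ge> (e @ [c]) ! (i + 1)"
      show "(e @ [c]) ! i \<le> m"
      proof (cases "i + 1 < length e")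
        case True
        then show ?thesis using i R by (simp add: nth_append hght_le_iff)
      next
        case False
        then have "e \<noteq> []" "i = length e - 1" using i by (cases e; auto)+
        then show ?thesis using i R by (simp add: nth_append last_conv_nth)
      qed
    qed
  qed
  then show "hght (e @ [c]) \<le> m \<longleftrightarrow>
      (if e \<noteq> [] \<and> c \<le> last e then max (hght e) (last e) else hght e) \<le> m"
    by auto
qed

text \<open>The last occurrence of the maximum is either the final entry or is followed by a smaller
  entry, which makes it a candidate for the height.\<close>

lemma max_val_eq: "max_val e = max (last0 e) (hght e)"
proof (induction e rule: rev_induct)
  case Nil
  then show ?case by (simp add: max_val_def last0_def)
next
  case (snoc c e)
  then show ?case
    by (auto simp: max_val_snoc hght_snoc_max last0_def max_def split: if_splits)
qed

text \<open>Positivity of \<open>c\<close> rules out the first case for the empty sequence, where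
  \<open>last0\<close> is 0; otherwise \<open>max_val_eq\<close> applies.\<close>

lemma hght_snoc: "1 \<le> c \<Longrightarrow> hght (e @ [c]) = (if c \<le> last0 e then max_val e else hght e)"
  by (auto simp: hght_snoc_max max_val_eq last0_def max.commute)

text \<open>If the right neighbour of \<open>e ! i\<close> is not larger, \<open>k = i\<close>
  works; otherwise move on to \<open>i + 1\<close>, whose value is larger still.\<close>

lemma weak_descent_adjacent:
  assumes "i < j" "e ! j \<le> e ! i"
  shows "\<exists>k. i \<le> k \<and> k < j \<and> e ! i \<le> e ! k \<and> e ! (k + 1) \<le> (e ! k :: nat)"
  using assms
proof (induction "j - i" arbitrary: i rule: less_induct)
  case less
  show ?case
  proof (cases "e ! (i + 1) \<le> e ! i")
    case True
    then show ?thesis using less.prems by auto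
  next
    case False
    then have "i + 1 < j" using less.prems by (metis Suc_eq_plus1 Suc_lessI)
    then have "\<exists>k. i + 1 \<le> k \<and> k < j \<and> e ! (i + 1) \<le> e ! k \<and> e ! (k + 1) \<le> e ! k"
      using less.prems False by (intro less.hyps) auto
    then obtain k where "i + 1 \<le> k" "k < j" "e ! (i + 1) \<le> e ! k" "e ! (k + 1) \<le> e ! k"
      by blast
    then show ?thesis using False by (intro exI[of _ k]) auto
  qed
qed

text \<open>The right side says that two entries of \<open>e\<close>, followed by a later entry
  \<open>c\<close>, form the forbidden pattern. So the height is exactly the lower bound for entries
  that may be appended.\<close>

lemma hght_less_iff_pattern:
  "c < hght e \<longleftrightarrow> (\<exists>i j. i < j \<and> j < length e \<and> e ! i \<ge> e ! j \<and> e ! i > c)"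
proof
  assume "c < hght e"
  then obtain i where "i + 1 < length e" "e ! i \<ge> e ! (i + 1)" "e ! i > c"
    using hght_le_iff[of e c] by (auto simp: not_le)
  then show "\<exists>i j. i < j \<and> j < length e \<and> e ! i \<ge> e ! j \<and> e ! i > c"
    by (intro exI[of _ i] exI[of _ "i + 1"]) auto
next
  assume "\<exists>i j. i < j \<and> j < length e \<and> e ! i \<ge> e ! j \<and> e ! i > c"
  then obtain i j where ij: "i < j" "j < length e" "e ! i \<ge> e ! j" "e ! i > c"
    by blast
  then obtain k where "k < j" "e ! i \<le> e ! k" "e ! (k + 1) \<le> e ! k"
    using weak_descent_adjacent by blast
  then have "\<not> hght e \<le> c"
    using ij unfolding hght_le_iff by (auto intro!: exI[of _ k])
  then show "c < hght e" by simp
qed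

text \<open>A pattern in the longer sequence either lies in \<open>e\<close> or has \<open>c\<close>
  as its third entry; \<open>hght_less_iff_pattern\<close> decides the second case.\<close>

lemma snoc_in_useqs:
  "e @ [c] \<in> useqs (Suc n) \<longleftrightarrow> e \<in> useqs n \<and> hght e \<le> c \<and> 1 \<le> c \<and> c \<le> Suc n"
proof (cases "length e = n")
  case True
  let ?pat = "\<lambda>f m. \<exists>i j k. i < j \<and> j < k \<and> k < m \<and> f ! i \<ge> f ! j \<and> f ! i > (f ! k :: nat)"
  have nth: "(e @ [c]) ! i = (if i < n then e ! i else c)" if "i < Suc n" for i
    using that True by (auto simp: nth_append less_Suc_eq)
  have "?pat (e @ [c]) (Suc n) \<longleftrightarrow> ?pat e n \<or> c < hght e"
  proof
    assume "?pat (e @ [c]) (Suc n)"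
    then obtain i j k where ijk: "i < j" "j < k" "k < Suc n"
      "(e @ [c]) ! i \<ge> (e @ [c]) ! j" "(e @ [c]) ! i > (e @ [c]) ! k"
      by blast
    then have "e ! i \<ge> e ! j" "e ! i > (if k < n then e ! k else c)"
      using nth[of i] nth[of j] nth[of k] by auto
    then show "?pat e n \<or> c < hght e"
      using ijk True by (cases "k < n") (auto simp: hght_less_iff_pattern)
  next
    assume "?pat e n \<or> c < hght e"
    then show "?pat (e @ [c]) (Suc n)"
    proof
      assume "?pat e n"
      then obtain i j k where "i < j" "j < k" "k < n" "e ! i \<ge> e ! j" "e ! i > e ! k"
        by blast
      then show ?thesis
        by (intro exI[of _ i] exI[of _ j] exI[of _ k]) (simp add: nth)
    next
      assume "c < hght e"
      then obtain i j where "i < j" "j < n" "e ! i \<ge> e ! j" "e ! i > c"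
        using True by (auto simp: hght_less_iff_pattern)
      then show ?thesis
        by (intro exI[of _ i] exI[of _ j] exI[of _ n]) (simp add: nth)
    qed
  qed
  moreover have "(\<forall>i<Suc n. 1 \<le> (e @ [c]) ! i \<and> (e @ [c]) ! i \<le> i + 1) \<longleftrightarrow>
      (\<forall>i<n. 1 \<le> e ! i \<and> e ! i \<le> i + 1) \<and> 1 \<le> c \<and> c \<le> Suc n"
    using True by (auto simp: All_less_Suc nth_append)
  ultimately show ?thesis
    unfolding useqs_def using True by auto
next
  case False
  then show ?thesis by (simp add: useqs_def)
qed

lemma useqs_0: "useqs 0 = {[]}"
  by (auto simp: useqs_def)

lemma max_val_le_length: "e \<in> useqs n \<Longrightarrow> max_val e \<le> n"
  by (fastforce simp: useqs_def max_val_le_iff in_set_conv_nth)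

lemma max_val_pos:
  assumes "e \<in> useqs (Suc n)"
  shows "1 \<le> max_val e"
proof -
  have "e ! 0 \<in> set e" "1 \<le> e ! 0"
    using assms by (auto simp: useqs_def)
  then show ?thesis
    using max_val_le_iff[of e "max_val e"] by auto
qed

lemma hght_less_length:
  assumes "e \<in> useqs (Suc n)"
  shows "hght e \<le> n"
proof -
  have "e \<noteq> []" using assms by (auto simp: useqs_def)
  then obtain f c where e: "e = f @ [c]" by (metis rev_exhaust)
  then have "f \<in> useqs n" "1 \<le> c" using assms snoc_in_useqs by auto
  then show ?thesis
    using max_val_le_length[of f n] by (auto simp: e hght_snoc max_val_eq)
qed

text \<open>With the exponent \<open>dist\<close> instead of \<open>dist - 1\<close> the recurrences also hold for the empty sequence;
  all weights then carry one extra factor \<open>q\<close>.\<close>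

definition weight :: "'a::comm_ring_1 \<Rightarrow> nat list \<Rightarrow> 'a" where
  "weight q e = q ^ card (set e)"

lemma weight_snoc: "weight q (e @ [c]) = (if c \<in> set e then weight q e else q * weight q e)"
  by (simp add: weight_def insert_absorb)

section \<open>Weighted counts by last entry, height and maximum\<close>

definition u_wt :: "'a::comm_ring_1 \<Rightarrow> nat \<Rightarrow> nat \<Rightarrow> nat \<Rightarrow> 'a" where
  "u_wt q n i j = (\<Sum>e | e \<in> useqs n \<and> last0 e = i \<and> hght e = j. weight q e)"

definition max_wt :: "'a::comm_ring_1 \<Rightarrow> nat \<Rightarrow> nat \<Rightarrow> 'a" where
  "max_wt q n j = (\<Sum>e | e \<in> useqs n \<and> max_val e = j. weight q e)"

text \<open>The empty sequence is excluded: there \<open>dist_vals e - 1\<close> is truncated to 0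
  and \<open>last\<close> is unspecified.\<close>

lemma u_wt_conv_u:
  assumes "1 \<le> n"
  shows "u_wt q n i j = q * u q n i j"
proof -
  have "weight q e = q * q ^ (dist_vals e - 1)" and "last0 e = last e" if "e \<in> useqs n" for e
  proof -
    have "set e \<noteq> {}" using that assms by (auto simp: useqs_def)
    then have "card (set e) = Suc (dist_vals e - 1)" and "e \<noteq> []"
      by (auto simp: dist_vals_def card_gt_0_iff)
    then show "weight q e = q * q ^ (dist_vals e - 1)" and "last0 e = last e"
      by (auto simp: weight_def last0_def simp flip: power_Suc)
  qed
  then show ?thesis
    unfolding u_wt_def u_def sum_distrib_left by (intro sum.cong) auto
qed

lemma finite_useqs_Collect [simp]: "finite {e. e \<in> useqs n \<and> P e}"
  using finite_useqs[of n] by simp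

lemma sum_fibres:
  assumes "finite L"
  shows "(\<Sum>l\<in>L. \<Sum>e | e \<in> useqs n \<and> P e \<and> f e = l. g e)
       = (\<Sum>e | e \<in> useqs n \<and> P e \<and> f e \<in> L. g e)"
proof -
  have "(\<Sum>e | e \<in> useqs n \<and> P e \<and> f e \<in> L. g e)
      = (\<Sum>l\<in>L. \<Sum>e | e \<in> {e. e \<in> useqs n \<and> P e \<and> f e \<in> L} \<and> f e = l. g e)"
    using assms by (intro sum.group[symmetric]) auto
  also have "\<dots> = (\<Sum>l\<in>L. \<Sum>e | e \<in> useqs n \<and> P e \<and> f e = l. g e)"
    by (intro sum.cong refl) auto
  finally show ?thesis ..
qed

lemma sum_useqs_Suc:
  assumes "1 \<le> c" "c \<le> Suc n"
  shows "(\<Sum>e | e \<in> useqs (Suc n) \<and> last0 e = c \<and> P e. g e)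
       = (\<Sum>e | e \<in> useqs n \<and> hght e \<le> c \<and> P (e @ [c]). g (e @ [c]))"
proof -
  have "{e. e \<in> useqs (Suc n) \<and> last0 e = c \<and> P e}
      = (\<lambda>e. e @ [c]) ` {e. e \<in> useqs n \<and> hght e \<le> c \<and> P (e @ [c])}" (is "?L = ?R")
  proof
    show "?R \<subseteq> ?L" using assms by (auto simp: snoc_in_useqs)
    show "?L \<subseteq> ?R"
    proof
      fix e assume e: "e \<in> ?L"
      then have "e \<noteq> []" by (auto simp: useqs_def)
      then obtain f d where "e = f @ [d]" by (metis rev_exhaust)
      then show "e \<in> ?R" using e by (auto simp: snoc_in_useqs)
    qed
  qed
  then show ?thesis
    by (simp add: sum.reindex inj_on_def)
qed

lemma sum_useqs_split:
  "(\<Sum>e | e \<in> useqs n \<and> P e. g e)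
   = (\<Sum>e | e \<in> useqs n \<and> P e \<and> Q e. g e) + (\<Sum>e | e \<in> useqs n \<and> P e \<and> \<not> Q e. g e)"
  by (subst sum.union_disjoint[symmetric]) (auto intro: sum.cong)

text \<open>Whether or not the appended \<open>j\<close> exceeds the previous entry, height
  \<open>j\<close> afterwards means maximum \<open>j\<close> before, and then \<open>j\<close> is no
  new value.\<close>

lemma u_wt_eq:
  assumes "1 \<le> j" "j \<le> Suc n"
  shows "u_wt q (Suc n) j j = max_wt q n j"
proof -
  have "u_wt q (Suc n) j j = (\<Sum>e | e \<in> useqs n \<and> hght e \<le> j \<and> hght (e @ [j]) = j. weight q (e @ [j]))"
    unfolding u_wt_def by (rule sum_useqs_Suc[OF assms])
  also have "\<dots> = (\<Sum>e | e \<in> useqs n \<and> max_val e = j. weight q e)"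
  proof (rule sum.cong)
    show "{e. e \<in> useqs n \<and> hght e \<le> j \<and> hght (e @ [j]) = j} = {e. e \<in> useqs n \<and> max_val e = j}"
      using assms by (auto simp: hght_snoc max_val_eq split: if_splits)
    show "weight q (e @ [j]) = weight q e" if "e \<in> {e. e \<in> useqs n \<and> max_val e = j}" for e
      using that max_val_in_set[of e] assms by (auto simp: weight_snoc)
  qed
  finally show ?thesis by (simp add: max_wt_def)
qed

text \<open>If \<open>j\<close> did not exceed the previous entry, the height would become at least
  \<open>j\<close>. So \<open>j\<close> is appended above the maximum, keeps the height and is a new
  value.\<close>

lemma u_wt_below:
  assumes "i < j" "j \<le> Suc n"
  shows "u_wt q (Suc n) j i = q * (\<Sum>l<j. u_wt q n l i)"
proof -
  have "u_wt q (Suc n) j i = (\<Sum>e | e \<in> useqs n \<and> hght e \<le> j \<and> hght (e @ [j]) = i. weight q (e @ [j]))"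
    unfolding u_wt_def using assms by (intro sum_useqs_Suc) auto
  also have "\<dots> = (\<Sum>e | e \<in> useqs n \<and> hght e = i \<and> last0 e \<in> {..<j}. q * weight q e)"
  proof (rule sum.cong)
    show "{e. e \<in> useqs n \<and> hght e \<le> j \<and> hght (e @ [j]) = i}
        = {e. e \<in> useqs n \<and> hght e = i \<and> last0 e \<in> {..<j}}"
      using assms by (auto simp: hght_snoc max_val_eq split: if_splits)
    show "weight q (e @ [j]) = q * weight q e"
      if "e \<in> {e. e \<in> useqs n \<and> hght e = i \<and> last0 e \<in> {..<j}}" for e
      using that not_in_set_above_max_val[of e j] assms by (auto simp: weight_snoc max_val_eq)
  qed
  also have "\<dots> = (\<Sum>l<j. \<Sum>e | e \<in> useqs n \<and> hght e = i \<and> last0 e = l. q * weight q e)"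
    by (rule sum_fibres[symmetric]) simp
  finally show ?thesis
    by (simp add: u_wt_def sum_distrib_left conj_commute)
qed

text \<open>After summing over all heights below \<open>j\<close>, the only condition left is that
  the maximum before appending is below \<open>j\<close>.\<close>

lemma sum_u_wt_below:
  assumes "1 \<le> j" "j \<le> Suc n"
  shows "(\<Sum>i<j. u_wt q (Suc n) j i) = q * (\<Sum>l<j. max_wt q n l)"
proof -
  have "(\<Sum>i<j. u_wt q (Suc n) j i)
      = (\<Sum>e | e \<in> useqs (Suc n) \<and> last0 e = j \<and> hght e \<in> {..<j}. weight q e)"
    unfolding u_wt_def
    by (rule sum_fibres) simp
  also have "\<dots> = (\<Sum>e | e \<in> useqs n \<and> hght e \<le> j \<and> hght (e @ [j]) \<in> {..<j}. weight q (e @ [j]))"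
    by (rule sum_useqs_Suc[OF assms])
  also have "\<dots> = (\<Sum>e | e \<in> useqs n \<and> True \<and> max_val e \<in> {..<j}. q * weight q e)"
  proof (rule sum.cong)
    show "{e. e \<in> useqs n \<and> hght e \<le> j \<and> hght (e @ [j]) \<in> {..<j}}
        = {e. e \<in> useqs n \<and> True \<and> max_val e \<in> {..<j}}"
      using assms by (auto simp: hght_snoc max_val_eq split: if_splits)
    show "weight q (e @ [j]) = q * weight q e" if "e \<in> {e. e \<in> useqs n \<and> True \<and> max_val e \<in> {..<j}}" for e
      using that not_in_set_above_max_val[of e j] assms by (auto simp: weight_snoc)
  qed
  also have "\<dots> = (\<Sum>l<j. \<Sum>e | e \<in> useqs n \<and> True \<and> max_val e = l. q * weight q e)"
    by (rule sum_fibres[symmetric]) simp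
  finally show ?thesis
    by (simp add: max_wt_def sum_distrib_left)
qed

text \<open>The final \<open>i\<close> needs a prefix of height at most \<open>i\<close>, so the
  height \<open>j > i\<close> can only come from the entry just before it, which is thus
  \<open>j\<close>. Deleting this \<open>j\<close> and comparing the maximum of the rest with
  \<open>i\<close> gives the three terms.\<close>

lemma u_wt_above:
  assumes "1 \<le> i" "i < j" "j \<le> Suc n"
  shows "u_wt q (Suc (Suc n)) i j
       = q * (max_wt q n i + q * (\<Sum>l<i. max_wt q n l) + (\<Sum>l\<in>{i<..<j}. u_wt q (Suc n) i l))"
proof -
  have "u_wt q (Suc (Suc n)) i j
      = (\<Sum>e | e \<in> useqs (Suc n) \<and> hght e \<le> i \<and> hght (e @ [i]) = j. weight q (e @ [i]))"
    unfolding u_wt_def using assms by (intro sum_useqs_Suc) auto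
  also have "\<dots> = (\<Sum>e | e \<in> useqs (Suc n) \<and> last0 e = j \<and> hght e \<le> i. weight q (e @ [i]))"
    using assms by (intro sum.cong) (auto simp: hght_snoc max_val_eq split: if_splits)
  also have "\<dots> = (\<Sum>e | e \<in> useqs n \<and> hght e \<le> j \<and> hght (e @ [j]) \<le> i. weight q ((e @ [j]) @ [i]))"
    using assms by (intro sum_useqs_Suc) auto
  \<comment> \<open>The penultimate \<open>j\<close> exceeds all entries before it, so removing it
    costs exactly one factor \<open>q\<close>.\<close>
  also have "\<dots> = (\<Sum>e | e \<in> useqs n \<and> last0 e < j \<and> hght e \<le> i. q * weight q (e @ [i]))"
  proof (rule sum.cong)
    show "{e. e \<in> useqs n \<and> hght e \<le> j \<and> hght (e @ [j]) \<le> i}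
        = {e. e \<in> useqs n \<and> last0 e < j \<and> hght e \<le> i}"
      using assms by (auto simp: hght_snoc max_val_eq split: if_splits)
    fix e assume "e \<in> {e. e \<in> useqs n \<and> last0 e < j \<and> hght e \<le> i}"
    then have "j \<notin> set e" using not_in_set_above_max_val[of e j] assms by (auto simp: max_val_eq)
    then show "weight q ((e @ [j]) @ [i]) = q * weight q (e @ [i])"
      unfolding weight_snoc using assms by auto
  qed
  \<comment> \<open>Maximum below \<open>i\<close>: the final \<open>i\<close> is a new value.
    Maximum \<open>i\<close>: it is not. Maximum above \<open>i\<close>: it is the last entry
    \<open>l\<close>, as the height is at most \<open>i\<close>, and appending \<open>i\<close>
    gives last entry \<open>i\<close> and height \<open>l\<close>.\<close>
  also have "\<dots> = (\<Sum>e | e \<in> useqs n \<and> True \<and> max_val e \<in> {..<i}. q * weight q (e @ [i]))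
      + (\<Sum>e | e \<in> useqs n \<and> max_val e = i. q * weight q (e @ [i]))
      + (\<Sum>e | e \<in> useqs n \<and> hght e \<le> i \<and> last0 e \<in> {i<..<j}. q * weight q (e @ [i]))"
    (is "sum ?g _ = _")
  proof -
    have "{e. e \<in> useqs n \<and> (last0 e < j \<and> hght e \<le> i) \<and> max_val e < i}
        = {e. e \<in> useqs n \<and> True \<and> max_val e \<in> {..<i}}"
      and "{e. e \<in> useqs n \<and> ((last0 e < j \<and> hght e \<le> i) \<and> \<not> max_val e < i) \<and> max_val e = i}
        = {e. e \<in> useqs n \<and> max_val e = i}"
      and "{e. e \<in> useqs n \<and> ((last0 e < j \<and> hght e \<le> i) \<and> \<not> max_val e < i) \<and> max_val e \<noteq> i}
        = {e. e \<in> useqs n \<and> hght e \<le> i \<and> last0 e \<in> {i<..<j}}"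
      using assms by (auto simp: max_val_eq)
    then show ?thesis
      using sum_useqs_split[of ?g n "\<lambda>e. last0 e < j \<and> hght e \<le> i" "\<lambda>e. max_val e < i"]
        sum_useqs_split[of ?g n "\<lambda>e. (last0 e < j \<and> hght e \<le> i) \<and> \<not> max_val e < i" "\<lambda>e. max_val e = i"]
      by simp
  qed
  also have "(\<Sum>e | e \<in> useqs n \<and> True \<and> max_val e \<in> {..<i}. ?g e)
      = (\<Sum>e | e \<in> useqs n \<and> True \<and> max_val e \<in> {..<i}. q * (q * weight q e))"
    using not_in_set_above_max_val by (intro sum.cong) (auto simp: weight_snoc)
  also have "\<dots> = (\<Sum>l<i. \<Sum>e | e \<in> useqs n \<and> True \<and> max_val e = l. q * (q * weight q e))"
    by (rule sum_fibres[symmetric]) simp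
  also have "\<dots> = q * (q * (\<Sum>l<i. max_wt q n l))"
    by (simp add: max_wt_def sum_distrib_left)
  also have "(\<Sum>e | e \<in> useqs n \<and> max_val e = i. ?g e) = q * max_wt q n i"
    unfolding max_wt_def sum_distrib_left using max_val_in_set assms
    by (intro sum.cong) (auto simp: weight_snoc)
  also have "(\<Sum>e | e \<in> useqs n \<and> hght e \<le> i \<and> last0 e \<in> {i<..<j}. ?g e)
      = (\<Sum>l\<in>{i<..<j}. \<Sum>e | e \<in> useqs n \<and> hght e \<le> i \<and> last0 e = l. ?g e)"
    by (rule sum_fibres[symmetric]) simp
  also have "\<dots> = (\<Sum>l\<in>{i<..<j}. q * u_wt q (Suc n) i l)"
  proof (rule sum.cong)
    fix l assume l: "l \<in> {i<..<j}"
    have "u_wt q (Suc n) i l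
        = (\<Sum>e | e \<in> useqs n \<and> hght e \<le> i \<and> hght (e @ [i]) = l. weight q (e @ [i]))"
      unfolding u_wt_def using assms by (intro sum_useqs_Suc) auto
    also have "\<dots> = (\<Sum>e | e \<in> useqs n \<and> hght e \<le> i \<and> last0 e = l. weight q (e @ [i]))"
      using assms l by (intro sum.cong) (auto simp: hght_snoc max_val_eq split: if_splits)
    finally show "(\<Sum>e | e \<in> useqs n \<and> hght e \<le> i \<and> last0 e = l. ?g e) = q * u_wt q (Suc n) i l"
      by (simp add: sum_distrib_left)
  qed simp
  finally show ?thesis
    by (simp add: algebra_simps sum_distrib_left)
qed

text \<open>By \<open>max_val_eq\<close>, maximum \<open>j\<close> leaves three cases, one per
  summand: last entry and height both \<open>j\<close>, only the height smaller, only the last entry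
  smaller.\<close>

lemma max_wt_Suc:
  assumes "1 \<le> j" "j \<le> Suc n"
  shows "max_wt q (Suc n) j = max_wt q n j + q * (\<Sum>l<j. max_wt q n l) + (\<Sum>i\<in>{1..<j}. u_wt q (Suc n) i j)"
proof -
  let ?W = "\<lambda>P. \<Sum>e | e \<in> useqs (Suc n) \<and> P e. weight q e"
  have "max_wt q (Suc n) j = ?W (\<lambda>e. last0 e = j \<and> hght e = j) + ?W (\<lambda>e. last0 e = j \<and> hght e \<in> {..<j})
      + ?W (\<lambda>e. hght e = j \<and> last0 e \<in> {..<j})"
  proof -
    have "{e. e \<in> useqs (Suc n) \<and> (max_val e = j \<and> last0 e = j) \<and> hght e = j}
        = {e. e \<in> useqs (Suc n) \<and> last0 e = j \<and> hght e = j}"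
      and "{e. e \<in> useqs (Suc n) \<and> (max_val e = j \<and> last0 e = j) \<and> hght e \<noteq> j}
        = {e. e \<in> useqs (Suc n) \<and> last0 e = j \<and> hght e \<in> {..<j}}"
      and "{e. e \<in> useqs (Suc n) \<and> max_val e = j \<and> last0 e \<noteq> j}
        = {e. e \<in> useqs (Suc n) \<and> hght e = j \<and> last0 e \<in> {..<j}}"
      by (auto simp: max_val_eq)
    then show ?thesis
      unfolding max_wt_def
      using sum_useqs_split[of "weight q" "Suc n" "\<lambda>e. max_val e = j" "\<lambda>e. last0 e = j"]
        sum_useqs_split[of "weight q" "Suc n" "\<lambda>e. max_val e = j \<and> last0 e = j" "\<lambda>e. hght e = j"]
      by simp
  qed
  also have "?W (\<lambda>e. last0 e = j \<and> hght e = j) = max_wt q n j"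
    using u_wt_eq[OF assms] by (simp add: u_wt_def)
  also have "?W (\<lambda>e. last0 e = j \<and> hght e \<in> {..<j}) = (\<Sum>i<j. u_wt q (Suc n) j i)"
    unfolding u_wt_def by (rule sum_fibres[symmetric]) simp
  also have "\<dots> = q * (\<Sum>l<j. max_wt q n l)"
    by (rule sum_u_wt_below[OF assms])
  also have "?W (\<lambda>e. hght e = j \<and> last0 e \<in> {..<j})
      = (\<Sum>i<j. \<Sum>e | e \<in> useqs (Suc n) \<and> hght e = j \<and> last0 e = i. weight q e)"
    by (rule sum_fibres[symmetric]) simp
  also have "\<dots> = (\<Sum>i<j. u_wt q (Suc n) i j)"
    by (simp add: u_wt_def conj_commute)
  also have "\<dots> = (\<Sum>i\<in>{1..<j}. u_wt q (Suc n) i j)"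
  proof (rule sum.mono_neutral_right)
    have "last0 e \<noteq> 0" if "e \<in> useqs (Suc n)" for e
      using that by (auto simp: useqs_def last0_def last_conv_nth)
    then have empty: "{e. e \<in> useqs (Suc n) \<and> last0 e = 0 \<and> hght e = j} = {}" by auto
    show "\<forall>i\<in>{..<j} - {1..<j}. u_wt q (Suc n) i j = 0"
    proof
      fix i assume "i \<in> {..<j} - {1..<j}"
      then have "i = 0" by auto
      then show "u_wt q (Suc n) i j = 0" by (simp only: u_wt_def empty sum.empty)
    qed
  qed auto
  finally show ?thesis .
qed

section \<open>Recurrences and their solution\<close>

lemma max_wt_gt_0: "n < j \<Longrightarrow> max_wt q n j = 0"
  unfolding max_wt_def by (rule sum.neutral) (use max_val_le_length in fastforce)

lemma max_wt_Suc_0: "max_wt q (Suc n) 0 = 0"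
  unfolding max_wt_def by (rule sum.neutral) (use max_val_pos in fastforce)

lemma max_wt_0_0: "max_wt q 0 0 = 1"
proof -
  have "{e. e \<in> useqs 0 \<and> max_val e = 0} = {[]}"
    by (auto simp: useqs_0 max_val_def)
  then show ?thesis by (simp add: max_wt_def weight_def)
qed

lemma u_wt_last0_0: "u_wt q (Suc n) 0 j = 0"
proof -
  have "last0 e \<noteq> 0" if "e \<in> useqs (Suc n)" for e
    using that by (auto simp: useqs_def last0_def last_conv_nth)
  then have "{e. e \<in> useqs (Suc n) \<and> last0 e = 0 \<and> hght e = j} = {}" by auto
  then show ?thesis by (simp only: u_wt_def sum.empty)
qed

text \<open>Compared with \<open>sum_u_wt_below\<close>, this is the equality of the two weights on
  which the recurrence rests. Raising \<open>j\<close> by one extends the inner sum of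
  \<open>u_wt_above\<close> by one term, which permits induction on \<open>j\<close>. For
  \<open>j = n + 1\<close> the left side would vanish, as the height is at most
  \<open>n\<close>.\<close>

lemma sum_u_wt_above:
  assumes "1 \<le> j" "j \<le> n"
  shows "(\<Sum>i\<in>{1..<j}. u_wt q (Suc n) i j) = q * (\<Sum>l<j. max_wt q n l)"
  using assms
proof (induction j rule: dec_induct)
  case base
  then obtain m where "n = Suc m" by (cases n) auto
  then show ?case by (simp add: max_wt_Suc_0)
next
  case (step j)
  then obtain m where n: "n = Suc m" by (cases n) auto
  have up: "u_wt q (Suc n) i (Suc j) = u_wt q (Suc n) i j + q * u_wt q n i j" if "i \<in> {1..<j}" for i
  proof -
    have "{i<..<Suc j} = insert j {i<..<j}" using that by auto
    then show ?thesis
      using u_wt_above[of i j m q] u_wt_above[of i "Suc j" m q] that step.prems step.hyps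
      by (simp add: n algebra_simps)
  qed
  have "{j<..<Suc j} = {}" by auto
  then have new: "u_wt q (Suc n) j (Suc j) = q * (max_wt q m j + q * (\<Sum>l<j. max_wt q m l))"
    using u_wt_above[of j "Suc j" m q] step.hyps step.prems by (simp add: n)
  have "(\<Sum>i\<in>{1..<Suc j}. u_wt q (Suc n) i (Suc j))
      = (\<Sum>i\<in>{1..<j}. u_wt q (Suc n) i j) + q * (\<Sum>i\<in>{1..<j}. u_wt q n i j)
        + u_wt q (Suc n) j (Suc j)"
    using step.hyps up by (simp add: sum.distrib sum_distrib_left)
  \<comment> \<open>The last two summands are \<open>q\<close> times the right side of
    \<open>max_wt_Suc\<close> for length \<open>n\<close>.\<close>
  also have "\<dots> = q * (\<Sum>l<j. max_wt q n l) + q * max_wt q n j"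
    using step max_wt_Suc[of j m q] new by (simp add: n algebra_simps)
  finally show ?case by (simp add: algebra_simps)
qed

lemma max_wt_Suc_le:
  assumes "1 \<le> j" "j \<le> n"
  shows "max_wt q (Suc n) j = max_wt q n j + 2 * q * (\<Sum>l<j. max_wt q n l)"
  using assms max_wt_Suc[of j n q] sum_u_wt_above[of j n q] by (simp add: algebra_simps)

text \<open>The height is at most \<open>n\<close>, so of the three cases of
  \<open>max_wt_Suc\<close> only a last entry above the height remains.\<close>

lemma max_wt_Suc_Suc: "max_wt q (Suc n) (Suc n) = q * (\<Sum>l\<le>n. max_wt q n l)"
proof -
  have "u_wt q (Suc n) i (Suc n) = 0" for i
    unfolding u_wt_def by (rule sum.neutral) (use hght_less_length in fastforce)
  then show ?thesis
    using max_wt_Suc[of "Suc n" n q] by (simp add: max_wt_gt_0 lessThan_Suc_atMost)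
qed

section \<open>Geometric series as diagonal sums\<close>

lemma sum_diag_fps:
  fixes C H :: "'a::comm_ring_1 fps"
  shows "Abs_fps (\<lambda>n. \<Sum>d\<le>n. (C * H ^ d) $ (n - d)) * (1 - fps_X * H) = C"
    (is "?F * _ = _")
proof (rule fps_ext)
  fix n
  \<comment> \<open>The series in question is \<open>C\<close> times the sum of all powers of
    \<open>fps_X * H\<close>. The truncation \<open>P\<close> agrees with it up to degree
    \<open>n\<close>, so a finite geometric sum suffices.\<close>
  define P where "P = (\<Sum>d\<le>n. fps_X ^ d * (C * H ^ d))"
  have P: "P $ i = ?F $ i" if "i \<le> n" for i
  proof -
    have "P $ i = (\<Sum>d\<le>n. if i < d then 0 else (C * H ^ d) $ (i - d))"
      by (simp add: P_def fps_sum_nth fps_X_power_mult_nth)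
    also have "\<dots> = (\<Sum>d\<le>i. if i < d then 0 else (C * H ^ d) $ (i - d))"
      using that by (intro sum.mono_neutral_right) auto
    also have "\<dots> = (\<Sum>d\<le>i. (C * H ^ d) $ (i - d))"
      by (rule sum.cong) auto
    finally show ?thesis by simp
  qed
  have "P * (1 - fps_X * H) = C * ((1 - fps_X * H) * (\<Sum>d\<le>n. (fps_X * H) ^ d))"
    by (simp add: P_def power_mult_distrib sum_distrib_left sum_distrib_right algebra_simps)
  also have "\<dots> = C * (1 - (fps_X * H) ^ Suc n)"
    by (simp only: one_diff_power_eq lessThan_Suc_atMost)
  also have "\<dots> = C - fps_X ^ Suc n * (C * H ^ Suc n)"
    by (simp only: power_mult_distrib) (simp add: algebra_simps)
  also have "\<dots> $ n = C $ n"
    by (simp only: fps_sub_nth fps_X_power_mult_nth) simp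
  finally have "(P * (1 - fps_X * H)) $ n = C $ n" .
  then show "(?F * (1 - fps_X * H)) $ n = C $ n"
    using P by (simp add: fps_mult_nth)
qed

text \<open>The inner sum is \<open>sum_diag_fps\<close> for \<open>K\<close>, the outer one is
  \<open>sum_diag_fps\<close> for \<open>H\<close> with numerator
  \<open>G = C / (1 - fps_X * K)\<close>.\<close>

lemma sum_diag2_fps:
  fixes C H K :: "'a::field fps"
  shows "Abs_fps (\<lambda>n. \<Sum>d\<le>n. \<Sum>s\<le>n - d. (C * K ^ s * H ^ d) $ (n - d - s))
    * ((1 - fps_X * K) * (1 - fps_X * H)) = C"
    (is "?F * _ = _")
proof -
  define G where "G = C * inverse (1 - fps_X * K)"
  have unit: "inverse (1 - fps_X * K) * (1 - fps_X * K) = 1"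
    by (rule inverse_mult_eq_1) simp
  have "(G * H ^ d) $ m = (\<Sum>s\<le>m. (C * K ^ s * H ^ d) $ (m - s))" for d m
  proof -
    let ?F = "Abs_fps (\<lambda>n. \<Sum>s\<le>n. (C * H ^ d * K ^ s) $ (n - s))"
    have "G * H ^ d = ?F * (1 - fps_X * K) * inverse (1 - fps_X * K)"
      by (simp only: sum_diag_fps) (simp add: G_def algebra_simps)
    also have "\<dots> = ?F"
      using unit by (simp add: mult.assoc mult.commute)
    finally show ?thesis by (simp add: mult_ac)
  qed
  then have "?F * (1 - fps_X * H) = G"
    using sum_diag_fps[of G H] by simp
  then have "?F * ((1 - fps_X * K) * (1 - fps_X * H)) = G * (1 - fps_X * K)"
    by (simp only: mult.assoc[symmetric] mult.commute[of "1 - fps_X * K"])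
  then show ?thesis
    using unit by (simp add: G_def mult.assoc)
qed

text \<open>The second geometric term is needed with \<open>H' = 0\<close>, where it is a correction at \<open>j = n\<close>, \<open>i = 1\<close> only.\<close>

lemma rec_solution:
  fixes F :: "nat \<Rightarrow> nat \<Rightarrow> nat \<Rightarrow> 'a::comm_ring_1"
  assumes rec: "\<And>n i j. 1 \<le> i \<Longrightarrow> i < j \<Longrightarrow> j \<le> Suc n \<Longrightarrow>
      F (Suc n) i j = q * (c n i + (\<Sum>l\<in>{i<..<j}. F n i l))"
    and c: "\<And>n i. 1 \<le> i \<Longrightarrow> i \<le> n \<Longrightarrow>
      c n i = (C * H ^ (n - i)) $ (i - 1) + (C' * H' ^ (n - i)) $ (i - 1)"
    and "1 \<le> i" "i < j" "j \<le> n"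
  shows "F n i j = q * ((C * (H + fps_const q) ^ (j - Suc i) * H ^ (n - j)) $ (i - 1)
      + (C' * (H' + fps_const q) ^ (j - Suc i) * H' ^ (n - j)) $ (i - 1))"
    (is "_ = q * ?f n j")
  using \<open>j \<le> n\<close> \<open>i < j\<close>
proof (induction n arbitrary: j)
  case 0
  then show ?case by simp
next
  case (Suc n)
  have "Suc i \<le> j" using Suc.prems by simp
  then show ?case
    using Suc.prems
  proof (induction j rule: dec_induct)
    case base
    have "{i<..<Suc i} = {}" by auto
    then show ?case
      using rec[of i "Suc i" n] c[of i n] base \<open>1 \<le> i\<close> by simp
  next
    case (step j)
    have "{i<..<Suc j} = insert j {i<..<j}" using step.hyps by auto
    then have "F (Suc n) i (Suc j) = F (Suc n) i j + q * F n i j"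
      using rec[of i j n] rec[of i "Suc j" n] step.hyps step.prems \<open>1 \<le> i\<close>
      by (simp add: algebra_simps)
    moreover have "F (Suc n) i j = q * ?f (Suc n) j"
      using step.hyps step.prems by (intro step.IH) auto
    moreover have "F n i j = q * ?f n j"
      using step.hyps step.prems by (intro Suc.IH) auto
    moreover have "?f (Suc n) (Suc j) = ?f (Suc n) j + q * ?f n j"
    proof -
      \<comment> \<open>This mirrors the difference equation in \<open>j\<close>: one factor
        \<open>G + fps_const q\<close> is split into its two summands.\<close>
      have step_fps: "D * (G + fps_const q) ^ (Suc j - Suc i) * G ^ (Suc n - Suc j)
          = D * (G + fps_const q) ^ (j - Suc i) * G ^ (Suc n - j)
            + fps_const q * (D * (G + fps_const q) ^ (j - Suc i) * G ^ (n - j))" for D G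
      proof -
        obtain s where "j = Suc i + s" using step.hyps by (metis le_Suc_ex)
        moreover obtain d where "n = j + d" using step.prems by (metis Suc_le_mono le_Suc_ex)
        ultimately show ?thesis by (simp add: Suc_diff_le algebra_simps)
      qed
      show ?thesis
        unfolding step_fps fps_add_nth fps_mult_left_const_nth by (simp add: distrib_left)
    qed
    ultimately show ?case by (simp only: distrib_left)
  qed
qed

text \<open>This is the series \<open>\<beta>\<close> of the introduction, with \<open>fps_X\<close>
  in place of \<open>z\<close>.\<close>

definition total_fps :: "'a::comm_ring_1 \<Rightarrow> 'a fps" where
  "total_fps q = Abs_fps (\<lambda>n. \<Sum>l\<le>n. max_wt q n l)"

lemma total_fps_nth_0 [simp]: "total_fps q $ 0 = 1"
  by (simp add: total_fps_def max_wt_0_0)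

section \<open>Solution of the recurrences by powers of \<open>h\<close>\<close>

context
  fixes q :: "'a::field" and h :: "'a fps"
  assumes h: "h = 1 + fps_X * (h * h - h + fps_const (2 * q) * h)"
begin

lemma h_nth_0: "h $ 0 = 1"
proof -
  have "h $ 0 = (1 + fps_X * (h * h - h + fps_const (2 * q) * h)) $ 0"
    using h by simp
  then show ?thesis by simp
qed

text \<open>The diagonal \<open>j = n\<close> is \<open>max_wt_Suc_Suc\<close>, which brings in
  \<open>total_fps\<close>. Off the diagonal, the difference of \<open>max_wt_Suc_le\<close> at
  \<open>j + 1\<close> and at \<open>j\<close> is the coefficient form of the equation for
  \<open>h\<close> multiplied by \<open>total_fps q * h ^ d\<close>.\<close>

lemma max_wt_eq:
  assumes "1 \<le> j" "j \<le> n"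
  shows "max_wt q n j = q * (total_fps q * h ^ (n - j)) $ (j - 1)"
  using assms
proof (induction n arbitrary: j)
  case 0
  then show ?case by simp
next
  case (Suc n)
  show ?case
  proof (cases "j = Suc n")
    case True
    then show ?thesis by (simp add: max_wt_Suc_Suc total_fps_def)
  next
    case False
    then have "j \<le> n" using Suc.prems by simp
    with \<open>1 \<le> j\<close> show ?thesis
    proof (induction j rule: dec_induct)
      case base
      then obtain m where "n = Suc m" by (cases n) auto
      then have "max_wt q (Suc n) 1 = max_wt q n 1"
        using max_wt_Suc_le[of 1 n q] by (simp add: max_wt_Suc_0)
      then show ?case
        using Suc.IH[of 1] base by (simp add: h_nth_0 fps_power_zeroth)
    next
      case (step j)
      obtain d where d: "n = Suc j + d" using step.prems by (metis le_Suc_ex)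
      obtain i where i: "j = Suc i" using step.hyps by (cases j) auto
      have "max_wt q (Suc n) (Suc j) = max_wt q n (Suc j) + max_wt q (Suc n) j - max_wt q n j + 2 * q * max_wt q n j"
        using max_wt_Suc_le[of "Suc j" n q] max_wt_Suc_le[of j n q] step.prems step.hyps
        by (simp add: algebra_simps)
      also have "\<dots> = q * ((total_fps q * h ^ d) $ j + (total_fps q * h ^ (d + 2)) $ i
          - (total_fps q * h ^ (d + 1)) $ i + 2 * q * (total_fps q * h ^ (d + 1)) $ i)"
        using step Suc.IH[of j] Suc.IH[of "Suc j"] by (simp add: d i algebra_simps)
      also have "\<dots> = q * (total_fps q * h ^ d + fps_X * (total_fps q * h ^ (d + 2) - total_fps q * h ^ (d + 1)
          + fps_const (2 * q) * (total_fps q * h ^ (d + 1)))) $ j"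
        by (simp add: i)
      also have "total_fps q * h ^ d + fps_X * (total_fps q * h ^ (d + 2) - total_fps q * h ^ (d + 1)
          + fps_const (2 * q) * (total_fps q * h ^ (d + 1)))
          = total_fps q * h ^ d * (1 + fps_X * (h * h - h + fps_const (2 * q) * h))"
        by (simp add: algebra_simps)
      also have "\<dots> = total_fps q * h ^ Suc d"
        by (simp only: h[symmetric]) (simp add: mult_ac)
      finally show ?case by (simp add: d)
    qed
  qed
qed

text \<open>Summing \<open>max_wt_eq\<close> over \<open>j\<close> makes
  \<open>total_fps q - 1\<close> a multiple of a diagonal sum.\<close>

lemma total_fps_eq: "(total_fps q - 1) * (1 - fps_X * h) = fps_const q * fps_X * total_fps q"
proof -
  let ?F = "Abs_fps (\<lambda>n. \<Sum>d\<le>n. (total_fps q * h ^ d) $ (n - d))"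
  have "total_fps q - 1 = fps_const q * fps_X * ?F"
  proof (rule fps_ext)
    fix n
    show "(total_fps q - 1) $ n = (fps_const q * fps_X * ?F) $ n"
    proof (cases n)
      case 0
      then show ?thesis by (simp add: mult.assoc)
    next
      case (Suc m)
      have "(total_fps q - 1) $ n = (\<Sum>l\<in>{1..n}. max_wt q n l)"
        using Suc sum.atLeast_Suc_atMost[of 0 n "max_wt q n"]
        by (simp add: total_fps_def max_wt_Suc_0 atMost_atLeast0)
      also have "\<dots> = (\<Sum>l\<in>{1..n}. q * (total_fps q * h ^ (n - l)) $ (l - 1))"
        using max_wt_eq by (intro sum.cong) auto
      also have "\<dots> = (\<Sum>d\<le>m. q * (total_fps q * h ^ d) $ (m - d))"
        by (rule sum.reindex_bij_witness[of _ "\<lambda>d. n - d" "\<lambda>l. n - l"]) (auto simp: Suc)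
      finally show ?thesis
        by (simp add: Suc mult.assoc sum_distrib_left)
    qed
  qed
  then have "(total_fps q - 1) * (1 - fps_X * h) = fps_const q * fps_X * (?F * (1 - fps_X * h))"
    by (simp add: mult.assoc)
  then show ?thesis by (simp only: sum_diag_fps)
qed

text \<open>Elimination between \<open>total_fps_eq\<close> and the equation for \<open>h\<close>
  gives the claim times \<open>?k\<close>, a series with constant term 1 that can be
  cancelled.\<close>

lemma total_fps_h: "total_fps q * (1 + h) = 2 * h"
proof -
  let ?k = "1 - fps_X * h - fps_const q * fps_X"
  have two: "fps_const (2 * q) = 2 * fps_const q"
    by (simp add: numeral_fps_const)
  have h': "h = 1 + fps_X * (h * h - h + 2 * fps_const q * h)"
    using h unfolding two .
  have "?k * (total_fps q * (1 + h) - 2 * h) = 0"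
    using h' total_fps_eq by algebra
  moreover have "?k \<noteq> 0"
  proof
    assume "?k = 0"
    then have "?k $ 0 = 0" by simp
    then show False by simp
  qed
  ultimately show ?thesis by simp
qed

text \<open>Passing from \<open>j\<close> to \<open>j + 1\<close> adds \<open>max_wt q n j\<close>,
  which \<open>total_fps_eq\<close> absorbs when read as an expression for
  \<open>total_fps q - 1\<close>.\<close>

lemma sum_max_wt_eq:
  assumes "1 \<le> j" "j \<le> Suc n" "1 \<le> n"
  shows "(\<Sum>l<j. max_wt q n l) = ((total_fps q - 1) * h ^ (Suc n - j)) $ (j - 1)"
  using assms(1,2)
proof (induction j rule: dec_induct)
  case base
  then show ?case using \<open>1 \<le> n\<close> by (cases n) (auto simp: max_wt_Suc_0)
next
  case (step j)
  obtain d where d: "n = j + d" using step.prems by (metis Suc_le_mono le_Suc_ex)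
  obtain i where i: "j = Suc i" using step.hyps by (cases j) auto
  have "(\<Sum>l<Suc j. max_wt q n l) = ((total_fps q - 1) * h ^ Suc d) $ i + q * (total_fps q * h ^ d) $ i"
    using step max_wt_eq[of j n] by (simp add: d i)
  also have "\<dots> = (fps_X * ((total_fps q - 1) * h ^ Suc d) + fps_const q * fps_X * total_fps q * h ^ d) $ j"
    by (simp add: i mult.assoc)
  also have "fps_X * ((total_fps q - 1) * h ^ Suc d) + fps_const q * fps_X * total_fps q * h ^ d
      = (total_fps q - 1) * h ^ d"
    unfolding total_fps_eq[symmetric] by (simp add: algebra_simps)
  finally show ?case by (simp add: d)
qed

text \<open>This is \<open>rec_solution\<close> for the recurrence \<open>u_wt_above\<close>. By
  \<open>total_fps_h\<close> the series \<open>total_fps\<close> drops out of the initial terms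
  \<open>c n i\<close>.\<close>

lemma u_wt_above_eq:
  assumes "1 \<le> i" "i < j" "j \<le> n"
  shows "u_wt q (Suc n) i j
    = q * (q * (h * (h + fps_const q) ^ (j - Suc i) * h ^ (n - j)) $ (i - 1))"
proof -
  define c where "c n i = max_wt q n i + q * (\<Sum>l<i. max_wt q n l)" for n i
  have c: "c n i = (fps_const q * h * h ^ (n - i)) $ (i - 1) + (0 * 0 ^ (n - i)) $ (i - 1)"
    if "1 \<le> i" "i \<le> n" for n i
  proof -
    have "c n i = q * (total_fps q * h ^ (n - i) + (total_fps q - 1) * h ^ Suc (n - i)) $ (i - 1)"
      using that sum_max_wt_eq[of i n] max_wt_eq[of i n]
      by (simp only: c_def fps_add_nth distrib_left) (simp add: Suc_diff_le)
    also have "total_fps q * h ^ (n - i) + (total_fps q - 1) * h ^ Suc (n - i)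
        = (total_fps q * (1 + h) - h) * h ^ (n - i)"
      by (simp add: algebra_simps)
    finally show ?thesis by (simp add: total_fps_h mult.assoc)
  qed
  have rec: "u_wt q (Suc (Suc n)) i j = q * (c n i + (\<Sum>l\<in>{i<..<j}. u_wt q (Suc n) i l))"
    if "1 \<le> i" "i < j" "j \<le> Suc n" for n i j
    using u_wt_above[OF that] by (simp add: c_def)
  have "u_wt q (Suc n) i j = q * ((fps_const q * h * (h + fps_const q) ^ (j - Suc i)
      * h ^ (n - j)) $ (i - 1) + (0 * (0 + fps_const q) ^ (j - Suc i) * 0 ^ (n - j)) $ (i - 1))"
    by (rule rec_solution[where F = "\<lambda>n. u_wt q (Suc n)" and c = c, OF rec c assms])
  then show ?thesis by (simp add: mult.assoc)
qed

text \<open>The subtracted part vanishes unless \<open>i = 1\<close> and \<open>j = n\<close>. There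
  it removes the weight \<open>q ^ n\<close> of the sequence 1, 2, ..., n, whose height is 0 and not
  1.\<close>

lemma u_wt_below_eq:
  assumes "1 \<le> i" "i < j" "j \<le> n"
  shows "u_wt q n j i
    = q * (q * ((h + fps_const q) ^ (j - Suc i) * h ^ (n - j)) $ (i - 1)
         - q * (fps_const q ^ (j - Suc i) * 0 ^ (n - j)) $ (i - 1))"
proof -
  define c where "c n i = (\<Sum>l\<le>i. u_wt q n l i)" for n i
  have c: "c n i = (fps_const q * h ^ (n - i)) $ (i - 1) + (- fps_const q * 0 ^ (n - i)) $ (i - 1)"
    if i: "1 \<le> i" "i \<le> n" for n i
  proof -
    obtain m where m: "n = Suc m" using i by (cases n) auto
    have "c n i = (\<Sum>l<i. u_wt q n l i) + u_wt q n i i"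
      by (simp add: c_def flip: lessThan_Suc_atMost)
    also have "(\<Sum>l<i. u_wt q n l i) = (\<Sum>l\<in>{1..<i}. u_wt q n l i)"
      by (rule sum.mono_neutral_right) (auto simp: m u_wt_last0_0 not_less_eq_eq)
    \<comment> \<open>This is \<open>max_wt_Suc\<close>, solved for the sequences with height
      \<open>i\<close> and smaller last entry.\<close>
    also have "\<dots> = max_wt q n i - u_wt q n i i - q * (\<Sum>l<i. max_wt q m l)"
      using max_wt_Suc[of i m q] u_wt_eq[of i m q] i by (simp add: m)
    finally have c_eq: "c n i = max_wt q n i - q * (\<Sum>l<i. max_wt q m l)" by simp
    show ?thesis
    proof (cases m)
      \<comment> \<open>The only sequence of length 1 has height 0, so \<open>c 1 1\<close> is 0 and
        the correction has to cancel \<open>q\<close>.\<close>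
      case 0
      then have "i = 1" "n = 1" using i m by auto
      then show ?thesis using c_eq max_wt_eq[of 1 1] 0 by (simp add: max_wt_0_0)
    next
      case (Suc k)
      \<comment> \<open>Now \<open>n \<ge> 2\<close>, so \<open>n = i\<close> forces the coefficient
        index \<open>i - 1\<close> to be positive.\<close>
      have "(0 ^ (n - i) :: 'a fps) $ (i - 1) = 0"
        using i m Suc by (cases "n = i") (auto simp: power_0_left)
      moreover have "c n i = q * (total_fps q * h ^ (n - i) - (total_fps q - 1) * h ^ (n - i)) $ (i - 1)"
      proof -
        have "(\<Sum>l<i. max_wt q m l) = ((total_fps q - 1) * h ^ (n - i)) $ (i - 1)"
          using i sum_max_wt_eq[of i m] unfolding m Suc by simp
        then show ?thesis
          by (simp only: c_eq max_wt_eq[OF i] fps_sub_nth right_diff_distrib)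
      qed
      ultimately show ?thesis by (simp add: algebra_simps)
    qed
  qed
  have rec: "u_wt q (Suc n) j i = q * (c n i + (\<Sum>l\<in>{i<..<j}. u_wt q n l i))"
    if "1 \<le> i" "i < j" "j \<le> Suc n" for n i j
  proof -
    have "{..<j} = {..i} \<union> {i<..<j}" "{..i} \<inter> {i<..<j} = {}" using that by auto
    then have "(\<Sum>l<j. u_wt q n l i) = c n i + (\<Sum>l\<in>{i<..<j}. u_wt q n l i)"
      unfolding c_def using sum.union_disjoint[of "{..i}" "{i<..<j}" "\<lambda>l. u_wt q n l i"] by simp
    then show ?thesis using u_wt_below[of i j n q] that by simp
  qed
  have "u_wt q n j i = q * ((fps_const q * (h + fps_const q) ^ (j - Suc i) * h ^ (n - j)) $ (i - 1)
      + (- fps_const q * (0 + fps_const q) ^ (j - Suc i) * 0 ^ (n - j)) $ (i - 1))"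
    by (rule rec_solution[where F = "\<lambda>n i j. u_wt q n j i" and c = c, OF rec c assms])
  then show ?thesis by (simp add: mult.assoc)
qed

end

section \<open>Generating functions\<close>

text \<open>The new indices \<open>d = N + 2 - i\<close> and \<open>s = i - 1 - j\<close> are the
  exponents of the two geometric ratios, which gives the shape of
  \<open>sum_diag2_fps\<close>.\<close>

lemma sum_lower_triangle:
  fixes f :: "nat \<Rightarrow> nat \<Rightarrow> 'a::comm_monoid_add"
  shows "(\<Sum>i=2..N+2. \<Sum>j=1..i-1. f i j)
       = (\<Sum>d\<le>N. \<Sum>s\<le>N-d. f (N + 2 - d) (N - d - s + 1))"
proof (rule sum.reindex_bij_witness[of _ "\<lambda>d. N + 2 - d" "\<lambda>i. N + 2 - i"])
  fix i assume i: "i \<in> {2..N+2}"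
  show "(\<Sum>s\<le>N-(N+2-i). f (N + 2 - (N + 2 - i)) (N - (N + 2 - i) - s + 1)) = (\<Sum>j=1..i-1. f i j)"
    by (rule sum.reindex_bij_witness[of _ "\<lambda>j. i - 1 - j" "\<lambda>s. i - 1 - s"])
      (use i in \<open>auto intro!: arg_cong2[of _ _ _ _ f]\<close>)
qed auto

lemma sum_upper_triangle:
  fixes f :: "nat \<Rightarrow> nat \<Rightarrow> 'a::comm_monoid_add"
  shows "(\<Sum>i=1..N+1. \<Sum>j=i+1..N+2. f i j)
       = (\<Sum>d\<le>N. \<Sum>s\<le>N-d. f (N - d - s + 1) (N + 2 - d))"
proof -
  have "(\<Sum>i=1..N+1. \<Sum>j=i+1..N+2. f i j) = (\<Sum>j=2..N+2. \<Sum>i=1..j-1. f i j)"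
    by (subst (1 2) sum.Sigma, simp, simp, simp, simp)
      (rule sum.reindex_bij_witness[of _ prod.swap prod.swap], auto)
  then show ?thesis
    using sum_lower_triangle[of "\<lambda>i j. f j i" N] by simp
qed

lemma U_full_eq: "U_full q v w = U_plus q v w + U_minus q v w + U_zero q (v * w)"
proof (rule fps_ext)
  fix n
  define f where "f i j = u q n i j * v ^ i * w ^ j" for i j
  show "U_full q v w $ n = (U_plus q v w + U_minus q v w + U_zero q (v * w)) $ n"
  proof (cases "n \<ge> 2")
    case False
    then show ?thesis by (simp add: U_full_def U_plus_def U_minus_def U_zero_def)
  next
    case True
    then obtain N where N: "n = N + 2" by (metis le_Suc_ex add.commute)
    have "(\<Sum>i=1..n. \<Sum>j=1..n-1. f i j)
        = (\<Sum>i=1..n. \<Sum>j=1..n-1. (if i < j then f i j else 0) + (if j < i then f i j else 0)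
            + (if i = j then f i j else 0))"
      by (intro sum.cong) auto
    also have "\<dots> = (\<Sum>i=1..n. \<Sum>j=1..n-1. if i < j then f i j else 0)
        + (\<Sum>i=1..n. \<Sum>j=1..n-1. if j < i then f i j else 0)
        + (\<Sum>i=1..n. \<Sum>j=1..n-1. if i = j then f i j else 0)"
      by (simp only: sum.distrib)
    also have "(\<Sum>i=1..n. \<Sum>j=1..n-1. if i < j then f i j else 0)
        = (\<Sum>i=1..n-2. \<Sum>j=1..n-1. if i < j then f i j else 0)"
      by (rule sum.mono_neutral_right) (auto intro!: sum.neutral)
    also have "\<dots> = (\<Sum>i=1..n-2. \<Sum>j=i+1..n-1. f i j)"
      by (intro sum.cong refl sum.mono_neutral_cong_right) auto
    also have "(\<Sum>i=1..n. \<Sum>j=1..n-1. if j < i then f i j else 0)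
        = (\<Sum>i=2..n. \<Sum>j=1..n-1. if j < i then f i j else 0)"
      by (rule sum.mono_neutral_right) (auto intro!: sum.neutral)
    also have "\<dots> = (\<Sum>i=2..n. \<Sum>j=1..i-1. f i j)"
      by (intro sum.cong refl sum.mono_neutral_cong_right) auto
    also have "(\<Sum>i=1..n. \<Sum>j=1..n-1. if i = j then f i j else 0)
        = (\<Sum>i=1..n-1. \<Sum>j=1..n-1. if i = j then f i j else 0)"
      by (rule sum.mono_neutral_right) (auto intro!: sum.neutral)
    also have "\<dots> = (\<Sum>i=1..n-1. f i i)"
      by (intro sum.cong refl) simp
    \<comment> \<open>For \<open>n = 2\<close> the coefficient of \<open>U_plus\<close> is 0 by
      definition and the sum over \<open>i < j\<close> is empty.\<close>
    finally show ?thesis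
      using True
      by (cases "n = 2") (auto simp: U_full_def U_plus_def U_minus_def U_zero_def f_def
          power_mult_distrib mult.assoc)
  qed
qed

section \<open>Equations for the three generating functions in terms of \<open>h\<close>\<close>

context
  fixes q :: "'a::field" and h :: "'a fps"
  assumes h: "h = 1 + fps_X * (h * h - h + fps_const (2 * q) * h)" and q: "q \<noteq> 0"
begin

text \<open>Since \<open>u_wt\<close> is \<open>q\<close> times \<open>u\<close>, a nonzero
  \<open>q\<close> can be cancelled. The factor \<open>v ^ (i - 1)\<close> is absorbed by
  substituting \<open>v * x\<close> for \<open>x\<close>.\<close>

lemma U_zero_eq:
  "U_zero q v * (1 - fps_X * (h oo (fps_const v * fps_X)))
   = fps_const v * fps_X^2 * (total_fps q oo (fps_const v * fps_X))"
proof -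
  define Z where "Z = fps_const v * fps_X"
  define F where "F = Abs_fps (\<lambda>n. \<Sum>d\<le>n. ((total_fps q oo Z) * (h oo Z) ^ d) $ (n - d))"
  have comp: "(total_fps q oo Z) * (h oo Z) ^ d = (total_fps q * h ^ d) oo Z" for d
    by (simp add: Z_def fps_compose_mult_distrib fps_compose_power)
  have Z_nth: "(g oo Z) $ m = v ^ m * g $ m" for g :: "'a fps" and m
    by (simp add: Z_def)
  have "U_zero q v = fps_X^2 * (fps_const v * F)"
  proof (rule fps_ext)
    fix n
    show "U_zero q v $ n = (fps_X^2 * (fps_const v * F)) $ n"
    proof (cases "n \<ge> 2")
      case False
      then show ?thesis by (simp add: U_zero_def fps_X_power_mult_nth)
    next
      case True
      then obtain N where N: "n = Suc (Suc N)" by (metis add_2_eq_Suc le_Suc_ex)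
      have "u q n i i = (total_fps q * h ^ (Suc N - i)) $ (i - 1)" if "i \<in> {1..Suc N}" for i
        using that q u_wt_conv_u[of n q i i] u_wt_eq[of i "Suc N" q] max_wt_eq[OF h, of i "Suc N"]
        by (simp add: N)
      then have "U_zero q v $ n
          = (\<Sum>i=1..Suc N. (total_fps q * h ^ (Suc N - i)) $ (i - 1) * v ^ i)"
        by (simp add: U_zero_def N)
      also have "\<dots> = (\<Sum>d\<le>N. (total_fps q * h ^ d) $ (N - d) * v ^ Suc (N - d))"
        by (rule sum.reindex_bij_witness[of _ "\<lambda>d. Suc N - d" "\<lambda>i. Suc N - i"])
          (auto simp: Suc_diff_le)
      also have "\<dots> = v * F $ N"
        unfolding F_def fps_nth_Abs_fps comp Z_nth sum_distrib_left
        by (intro sum.cong refl) (simp add: mult_ac)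
      finally show ?thesis
        by (simp add: N fps_X_power_mult_nth)
    qed
  qed
  then have "U_zero q v * (1 - fps_X * (h oo Z)) = fps_X^2 * fps_const v * (F * (1 - fps_X * (h oo Z)))"
    by (simp add: mult_ac)
  then show ?thesis
    unfolding F_def sum_diag_fps by (simp add: Z_def mult_ac)
qed

text \<open>With \<open>s = j - i - 1\<close>, the monomial \<open>v ^ i * w ^ j\<close> is
  \<open>v * w^2 * (v * w) ^ (i - 1) * w ^ s\<close>: the power of \<open>v * w\<close> becomes the
  substitution in \<open>h\<close>, and \<open>w ^ s\<close> goes into the ratio.\<close>

lemma U_plus_eq:
  fixes v w
  defines "H \<equiv> h oo (fps_const (v * w) * fps_X)"
  shows "U_plus q v w * ((1 - fps_X * (fps_const w * (H + fps_const q))) * (1 - fps_X * H))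
   = fps_const (q * v * w^2) * fps_X^3 * H"
proof -
  define Z where "Z = fps_const (v * w) * fps_X"
  define K where "K = fps_const w * (H + fps_const q)"
  define F where "F = Abs_fps (\<lambda>n. \<Sum>d\<le>n. \<Sum>s\<le>n-d. (H * K ^ s * H ^ d) $ (n - d - s))"
  have comp: "H * K ^ s * H ^ d = fps_const (w ^ s) * ((h * (h + fps_const q) ^ s * h ^ d) oo Z)" for s d
    by (simp add: H_def K_def Z_def fps_compose_mult_distrib fps_compose_power fps_compose_add_distrib
        power_mult_distrib fps_const_power mult_ac flip: fps_compose_power)
  have Z_nth: "(g oo Z) $ m = (v * w) ^ m * g $ m" for g :: "'a fps" and m
    by (simp add: Z_def)
  have "U_plus q v w = fps_X^3 * (fps_const (q * v * w^2) * F)"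
  proof (rule fps_ext)
    fix n
    show "U_plus q v w $ n = (fps_X^3 * (fps_const (q * v * w^2) * F)) $ n"
    proof (cases "n \<ge> 3")
      case False
      then show ?thesis by (simp add: U_plus_def fps_X_power_mult_nth)
    next
      case True
      then obtain N where N: "n = N + 3" by (metis le_Suc_ex add.commute)
      have u: "u q n i j = q * (h * (h + fps_const q) ^ (j - Suc i) * h ^ (N + 2 - j)) $ (i - 1)"
        if "1 \<le> i" "i < j" "j \<le> N + 2" for i j
        using q u_wt_conv_u[of n q i j] u_wt_above_eq[OF h that] by (simp add: N numeral_3_eq_3)
      have "U_plus q v w $ n = (\<Sum>i=1..N+1. \<Sum>j=i+1..N+2. u q n i j * v ^ i * w ^ j)"
        by (simp add: U_plus_def N)
      also have "\<dots> = (\<Sum>d\<le>N. \<Sum>s\<le>N-d.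
          u q n (N - d - s + 1) (N + 2 - d) * v ^ (N - d - s + 1) * w ^ (N + 2 - d))"
        by (rule sum_upper_triangle)
      also have "\<dots> = (\<Sum>d\<le>N. \<Sum>s\<le>N-d. q * v * w^2 * (H * K ^ s * H ^ d) $ (N - d - s))"
      proof (intro sum.cong refl)
        fix d s assume "d \<in> {..N}" "s \<in> {..N-d}"
        then obtain m where m: "N = d + s + m" by (metis atMost_iff le_Suc_ex le_diff_conv2 add.assoc add.commute)
        have "u q n (N - d - s + 1) (N + 2 - d)
            = q * (h * (h + fps_const q) ^ s * h ^ d) $ m"
          using u[of "m + 1" "m + s + 2"] by (simp add: m add_ac)
        then show "u q n (N - d - s + 1) (N + 2 - d) * v ^ (N - d - s + 1) * w ^ (N + 2 - d)
            = q * v * w^2 * (H * K ^ s * H ^ d) $ (N - d - s)"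
          unfolding comp fps_mult_left_const_nth Z_nth
          by (simp add: m power_add power_mult_distrib power2_eq_square mult_ac)
      qed
      also have "\<dots> = q * v * w^2 * F $ N"
        by (simp add: F_def sum_distrib_left)
      finally show ?thesis
        by (simp add: N fps_X_power_mult_nth)
    qed
  qed
  then have "U_plus q v w * ((1 - fps_X * K) * (1 - fps_X * H))
      = fps_X^3 * fps_const (q * v * w^2) * (F * ((1 - fps_X * K) * (1 - fps_X * H)))"
    by (simp only: mult_ac)
  also have "F * ((1 - fps_X * K) * (1 - fps_X * H)) = H"
    unfolding F_def by (rule sum_diag2_fps)
  finally show ?thesis
    by (simp add: K_def mult_ac)
qed

text \<open>The main part of \<open>u_wt_below_eq\<close> sums to \<open>1 / M\<close> and the
  correction to \<open>1 / (1 - q * v * x)\<close>; the claim is their difference with denominators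
  cleared.\<close>

lemma U_minus_eq:
  fixes v w
  defines "H \<equiv> h oo (fps_const (v * w) * fps_X)"
  defines "M \<equiv> (1 - fps_X * (fps_const v * (H + fps_const q))) * (1 - fps_X * H)"
  shows "U_minus q v w * M * (1 - fps_const (q * v) * fps_X)
   = fps_const (q * v^2 * w) * fps_X^2 * ((1 - fps_const (q * v) * fps_X) - M)"
proof -
  define Z where "Z = fps_const (v * w) * fps_X"
  define K where "K = fps_const v * (H + fps_const q)"
  define F where "F = Abs_fps (\<lambda>n. \<Sum>d\<le>n. \<Sum>s\<le>n-d. (1 * K ^ s * H ^ d) $ (n - d - s))"
  define F' :: "'a fps" where
    "F' = Abs_fps (\<lambda>n. \<Sum>d\<le>n. \<Sum>s\<le>n-d. (1 * fps_const (v * q) ^ s * 0 ^ d) $ (n - d - s))"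
  have comp: "K ^ s * H ^ d = fps_const (v ^ s) * (((h + fps_const q) ^ s * h ^ d) oo Z)" for s d
    by (simp add: H_def K_def Z_def fps_compose_mult_distrib fps_compose_power fps_compose_add_distrib
        power_mult_distrib fps_const_power mult_ac flip: fps_compose_power)
  have Z_nth: "(g oo Z) $ m = (v * w) ^ m * g $ m" for g :: "'a fps" and m
    by (simp add: Z_def)
  have "U_minus q v w = fps_X^2 * (fps_const (q * v^2 * w) * (F - F'))"
  proof (rule fps_ext)
    fix n
    show "U_minus q v w $ n = (fps_X^2 * (fps_const (q * v^2 * w) * (F - F'))) $ n"
    proof (cases "n \<ge> 2")
      case False
      then show ?thesis by (simp add: U_minus_def fps_X_power_mult_nth)
    next
      case True
      then obtain N where N: "n = N + 2" by (metis le_Suc_ex add.commute)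
      have u: "u q n j i = q * ((h + fps_const q) ^ (j - Suc i) * h ^ (n - j)) $ (i - 1)
          - q * (fps_const q ^ (j - Suc i) * 0 ^ (n - j)) $ (i - 1)"
        if "1 \<le> i" "i < j" "j \<le> n" for i j
        using q u_wt_conv_u[of n q j i] u_wt_below_eq[OF h that] by (simp add: N)
      have "U_minus q v w $ n = (\<Sum>i=2..N+2. \<Sum>j=1..i-1. u q n i j * v ^ i * w ^ j)"
        by (simp add: U_minus_def N)
      also have "\<dots> = (\<Sum>d\<le>N. \<Sum>s\<le>N-d.
          u q n (N + 2 - d) (N - d - s + 1) * v ^ (N + 2 - d) * w ^ (N - d - s + 1))"
        by (rule sum_lower_triangle)
      also have "\<dots> = (\<Sum>d\<le>N. \<Sum>s\<le>N-d. q * v^2 * w * ((1 * K ^ s * H ^ d) $ (N - d - s)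
          - (1 * fps_const (v * q) ^ s * 0 ^ d) $ (N - d - s)))"
      proof (intro sum.cong refl)
        fix d s assume "d \<in> {..N}" "s \<in> {..N-d}"
        then obtain m where m: "N = d + s + m" by (metis atMost_iff le_Suc_ex le_diff_conv2 add.assoc add.commute)
        have "u q n (N + 2 - d) (N - d - s + 1)
            = q * ((h + fps_const q) ^ s * h ^ d) $ m - q * (fps_const q ^ s * 0 ^ d) $ m"
          using u[of "m + 1" "m + s + 2"] by (simp add: m N add_ac)
        \<comment> \<open>Both sides vanish unless \<open>d = 0\<close> and \<open>m = 0\<close>,
          where the powers \<open>v ^ m * w ^ m\<close> are 1.\<close>
        moreover have "(fps_const (v * q) ^ s * 0 ^ d :: 'a fps) $ m
            = v ^ s * (v ^ m * w ^ m) * (fps_const q ^ s * 0 ^ d) $ m"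
          by (cases "d = 0"; cases "m = 0")
            (simp_all add: power_0_left fps_const_power power_mult_distrib mult_ac)
        moreover have "v ^ (N + 2 - d) = v^2 * v ^ s * v ^ m" "w ^ (N - d - s + 1) = w * w ^ m"
            "N - d - s = m"
          by (simp_all add: m power_add power2_eq_square mult_ac)
        ultimately show "u q n (N + 2 - d) (N - d - s + 1) * v ^ (N + 2 - d) * w ^ (N - d - s + 1)
            = q * v^2 * w * ((1 * K ^ s * H ^ d) $ (N - d - s)
              - (1 * fps_const (v * q) ^ s * 0 ^ d) $ (N - d - s))"
          by (simp only: mult_1 comp fps_mult_left_const_nth Z_nth power_mult_distrib)
            (simp only: algebra_simps)
      qed
      also have "\<dots> = q * v^2 * w * (F - F') $ N"
        by (simp add: F_def F'_def sum_distrib_left sum_subtractf right_diff_distrib)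
      finally show ?thesis
        by (simp add: N fps_X_power_mult_nth)
    qed
  qed
  moreover have "F * M = 1"
    unfolding F_def M_def K_def by (rule sum_diag2_fps)
  moreover have "F' * ((1 - fps_X * fps_const (v * q)) * (1 - fps_X * 0)) = 1"
    unfolding F'_def by (rule sum_diag2_fps)
  then have "F' * (1 - fps_const (q * v) * fps_X) = 1"
    by (simp add: mult_ac)
  ultimately show ?thesis by algebra
qed

end

section \<open>Elimination of the kernel root\<close>

text \<open>Here \<open>k\<close> stands for \<open>1 / h\<close> at \<open>z\<close>. If
  \<open>l\<close> is the other root of its quadratic equation, \<open>(k - x) * (l - x)\<close> and
  \<open>(1 + k) * (1 + l)\<close> are free of \<open>k\<close>: they are \<open>x\<close> and
  \<open>-2\<close> times the two nonconstant factors of the denominator.\<close>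

lemma eliminate_zero:
  fixes x v q k t z U :: "'b::idom"
  assumes k: "k * k = (1 + z - 2 * q * z) * k - z" and t: "t = 2 * k - (1 + z - 2 * q * z)"
    and z: "z = v * x" and U: "(k - x) * (1 + k) * U = 2 * k * v * x^2"
    and nz: "k - x \<noteq> 0" "1 + k \<noteq> 0"
  shows "U * (2 * (2*v*q*x - v*x + v + x - 1) * (v*q*x - v*x - 1))
    = v*x^2 * (2*(v - 1)*v*q*x - (v - 3)*v*x - 3*v + 1) + v*(v + 1)*x^2 * t" (is "_ * ?D = ?N")
proof -
  have "2 * k * v * x^2 * ?D = (k - x) * (1 + k) * ?N"
    using k unfolding t z by algebra
  then have "(k - x) * (1 + k) * (U * ?D) = (k - x) * (1 + k) * ?N"
    using U by (metis mult.assoc)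
  with nz show ?thesis by simp
qed

text \<open>Again both denominator factors are products over the two roots,
  \<open>(k - x) * (l - x) = x * \<Gamma>\<close> and \<open>r * s = - w * x * \<Theta>\<close>.
  Rationalising \<open>U\<close> brings the conjugates \<open>l - x\<close> and \<open>s\<close>
  into the numerator.\<close>

lemma eliminate_plus:
  fixes x v w q k t z U :: "'b::idom"
  defines "\<Gamma> \<equiv> 2*v*w*q*x - v*w*x + v*w + x - 1"
  defines "\<Theta> \<equiv> v*w^2*q^2*x^2 - v*w^2*q*x^2 - w*q*x + v*w*x - w*x - v + 1"
  assumes k: "k * k = (1 + z - 2 * q * z) * k - z" and t: "t = 2 * k - (1 + z - 2 * q * z)"
    and z: "z = v * w * x"
    and U: "(k - w * x * (1 + q * k)) * (k - x) * U = q * w * x^2 * z * k"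
    and nz: "k - x \<noteq> 0" "k - w * x * (1 + q * k) \<noteq> 0"
  shows "U * (2 * \<Gamma> * \<Theta>)
    = - (v*w^2*q*x^2 * (v*w*q*x - v + x) * t
            + v*w^2*q*x^2 * ((2*v*w*q^2 - v*w*q + 1)*v*w*x^2
                - (2*v^2*w*q + v*w*q - v^2*w + 2*v*w + 2*v - 1)*x + v))" (is "_ = ?N")
proof -
  define l where "l = 1 + z - 2 * q * z - k" \<comment> \<open>the other root of the quadratic equation of \<open>k\<close>\<close>
  define r where "r = k - w * x * (1 + q * k)"
  define s where "s = l - w * x * (1 + q * l)"
  have rs: "r * s = - w * x * \<Theta>"
    using k unfolding r_def s_def \<Theta>_def l_def z by algebra
  \<comment> \<open>As \<open>k * l = z\<close>, the conjugate \<open>l - x\<close> times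
    \<open>k\<close> is \<open>x * (v * w - k)\<close>.\<close>
  have \<Gamma>: "x * (v * w - k) * (k - x) = k * x * \<Gamma>"
    using k unfolding \<Gamma>_def z by algebra
  have N: "?N = - 2 * q * x * z * (v * w - k) * s"
  proof -
    have "2 * (v * w - k) * s = w * ((v*w*q*x - v + x) * t + ((2*v*w*q^2 - v*w*q + 1)*v*w*x^2
                - (2*v^2*w*q + v*w*q - v^2*w + 2*v*w + 2*v - 1)*x + v))"
      using k unfolding s_def t l_def z by algebra
    then show ?thesis unfolding z by algebra
  qed
  have "r * (k - x) * ?N = r * (k - x) * (U * (2 * \<Gamma> * \<Theta>))"
    unfolding N using U[folded r_def] rs \<Gamma> by algebra
  with nz show ?thesis by (simp add: r_def)
qed

text \<open>The assumption on \<open>U\<close> is \<open>U_minus_eq\<close> times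
  \<open>k^2\<close>. Conjugates produce \<open>\<Gamma>\<close> and \<open>\<Delta>\<close> as
  before; the third factor \<open>1 - q * v * x\<close> comes from the correction for 1, 2, ..., n
  and contains no \<open>k\<close>.\<close>

lemma eliminate_minus:
  fixes x v w q k t z U :: "'b::idom"
  defines "\<Gamma> \<equiv> 2*v*w*q*x - v*w*x + v*w + x - 1"
  defines "\<Delta> \<equiv> v^2*w*q^2*x^2 - v^2*w*q*x^2 - v*q*x + v*w*x - v*x - w + 1"
  assumes k: "k * k = (1 + z - 2 * q * z) * k - z" and t: "t = 2 * k - (1 + z - 2 * q * z)"
    and z: "z = v * w * x"
    and U: "(k - v * x * (1 + q * k)) * (k - x) * (1 - q * v * x) * U
      = q * z * v * x * (k^2 * (1 - q * v * x) - (k - v * x * (1 + q * k)) * (k - x))"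
    and nz: "k - x \<noteq> 0" "k - v * x * (1 + q * k) \<noteq> 0" "1 - q * v * x \<noteq> 0"
  shows "U * (2 * \<Delta> * (v*q*x - 1) * \<Gamma>)
    = v^2*w*q*x^2 * (v*w*q*x - v*w*x + v*w + w - 1) * t * (v*q*x - 1)
      + (- 2*v*(q + 1)*x^2 + (v*q + 2*v + 2)*x - 1) * v^2*w*q*x^2
      + (2*v^2*q*(q - 1)*x^3 - (3*v*q^2 - 2*(v + 1))*v*x^2
              - (v^2*q - 2*v*q + 2*(v + 1)^2)*x + v + 1) * v^2*w^2*q*x^2
      + (2*q - 1) * (v*q*x - 1) * (v*q*x - v*x + v + 1) * v^3*w^3*q*x^3" (is "_ = ?N")
proof -
  define p where "p = 1 - q * v * x"
  define l where "l = 1 + z - 2 * q * z - k" \<comment> \<open>the other root of the quadratic equation of \<open>k\<close>\<close>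
  define r where "r = k - v * x * (1 + q * k)"
  define s where "s = l - v * x * (1 + q * l)"
  have rs: "r * s = - v * x * \<Delta>"
    using k unfolding r_def s_def \<Delta>_def l_def z by algebra
  have \<Gamma>: "x * (v * w - k) * (k - x) = k * x * \<Gamma>"
    using k unfolding \<Gamma>_def z by algebra
  \<comment> \<open>This again uses \<open>k * l = z\<close>, with
    \<open>s = p * l - v * x\<close>.\<close>
  have s: "k * s = v * x * (p * w - k)"
    using k unfolding p_def s_def l_def z by algebra
  have N: "?N = q * z * v * x * (2 * p * (v * w - k) * (p * w - k) + 2 * \<Delta> * \<Gamma>)"
  proof -
    have "2 * p * (v * w - k) * (p * w - k) + 2 * \<Delta> * \<Gamma> =
      (v*w*q*x - v*w*x + v*w + w - 1) * t * (v*q*x - 1)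
      + (- 2*v*(q + 1)*x^2 + (v*q + 2*v + 2)*x - 1)
      + (2*v^2*q*(q - 1)*x^3 - (3*v*q^2 - 2*(v + 1))*v*x^2
              - (v^2*q - 2*v*q + 2*(v + 1)^2)*x + v + 1) * w
      + (2*q - 1) * (v*q*x - 1) * (v*q*x - v*x + v + 1) * v*w^2*x"
    proof -
      \<comment> \<open>Replacing \<open>k^2\<close> leaves an expression linear in
        \<open>k\<close>; what then remains is a plain polynomial identity.\<close>
      have "(v * w - k) * (p * w - k) = v * w^2 * p - (v + p) * w * k + ((1 + z - 2 * q * z) * k - z)"
        using k by algebra
      then have eq: "2 * p * (v * w - k) * (p * w - k) = 2 * p * (v * w^2 * p - (v + p) * w * k + ((1 + z - 2 * q * z) * k - z))"
        by (simp add: mult.assoc)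
      show ?thesis
        unfolding eq unfolding p_def \<Delta>_def \<Gamma>_def t z
        by algebra
    qed
    then show ?thesis unfolding z by algebra
  qed
  \<comment> \<open>The relations \<open>s\<close>, \<open>rs\<close> and \<open>\<Gamma>\<close>
    carry factors \<open>v * x\<close> and \<open>x\<close> that may be zero and cannot be
    cancelled. The prefactor \<open>z * v * x\<close> of the numerator contains their
    product.\<close>
  have "(v * w - k) * (p * w - k) * (r * (k - x)) * (v * x * x) = - (k^2 * \<Delta> * \<Gamma>) * (v * x * x)"
    using s rs \<Gamma> by algebra
  then have "z * v * x * ((v * w - k) * (p * w - k) * (r * (k - x))) = - (z * v * x * (k^2 * \<Delta> * \<Gamma>))"
    unfolding z by algebra
  then have "r * (k - x) * p * ?N = r * (k - x) * p * (U * (2 * \<Delta> * (v*q*x - 1) * \<Gamma>))"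
    unfolding N using U[folded r_def p_def] p_def by algebra
  with nz show ?thesis by (simp add: r_def p_def)
qed

section \<open>The kernel root as a power series\<close>

definition kernel_root :: "'a::field_char_0 \<Rightarrow> 'a fps" where
  "kernel_root q = fps_const (1/2) * (1 + fps_X - 2 * fps_const q * fps_X + t_series q)"

lemma kernel_root_nth_0: "kernel_root q $ 0 = 1"
  by (simp add: kernel_root_def t_series_nth_0 fps_mult_nth_0)

lemma two_kernel_root: "2 * kernel_root q = 1 + fps_X - 2 * fps_const q * fps_X + t_series q"
proof -
  have "2 * fps_const (1/2 :: 'a) = 1"
    by (simp add: numeral_fps_const)
  then show ?thesis
    by (simp add: kernel_root_def flip: mult.assoc)
qed

lemma t_series_eq: "t_series q = 2 * kernel_root q - (1 + fps_X - 2 * fps_const q * fps_X)"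
  by (simp add: two_kernel_root)

text \<open>The discriminant \<open>(1 + fps_X - 2 * q * fps_X)^2 - 4 * fps_X\<close> is
  \<open>t_radicand q\<close>. The sign of \<open>t_series\<close> in \<open>kernel_root\<close>
  selects the invertible root, with constant term 1.\<close>

lemma kernel_root_quadratic:
  "kernel_root q * kernel_root q = (1 + fps_X - 2 * fps_const q * fps_X) * kernel_root q - fps_X"
proof -
  have "fps_const ((1 - 2 * q)\<^sup>2) = (1 - 2 * fps_const q)^2" "fps_const (1 + 2 * q) = 1 + 2 * fps_const q"
    by (simp_all add: numeral_fps_const fps_const_power flip: fps_const_1_eq_1)
  then have "(t_series q)^2 = (1 - 2 * fps_const q)^2 * fps_X^2 - 2 * fps_X * (1 + 2 * fps_const q) + 1"
    by (simp add: t_series_square t_radicand_def)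
  then have "4 * (kernel_root q * kernel_root q - ((1 + fps_X - 2 * fps_const q * fps_X) * kernel_root q - fps_X)) = 0"
    unfolding t_series_eq by algebra
  then show ?thesis by (simp only: mult_eq_0_iff) simp
qed

lemma kernel_root_inverse: "inverse (kernel_root q) * kernel_root q = 1"
  by (rule inverse_mult_eq_1) (simp add: kernel_root_nth_0)

text \<open>Dividing the quadratic equation by the square of the root gives the equation assumed of
  \<open>h\<close>, so the earlier results apply to the reciprocal.\<close>

lemma inverse_kernel_root_eq:
  "inverse (kernel_root q) = 1 + fps_X * (inverse (kernel_root q) * inverse (kernel_root q) - inverse (kernel_root q)
     + fps_const (2 * q) * inverse (kernel_root q))"
proof -
  have two: "fps_const (2 * q) = 2 * fps_const q"
    by (simp add: numeral_fps_const)
  show ?thesis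
    unfolding two using kernel_root_quadratic[of q] kernel_root_inverse[of q] by algebra
qed

lemma total_fps_kernel_root: "total_fps q * (1 + kernel_root q) = 2"
  using total_fps_h[OF inverse_kernel_root_eq[of q]] kernel_root_inverse[of q] by algebra

lemma fps_eq_divideI:
  fixes F :: "'a::field fps"
  assumes "F * D = N" "D $ 0 \<noteq> 0"
  shows "F = N / D"
  using assms by (metis fps_nonzero_nth nonzero_mult_div_cancel_right fps_zero_nth)

lemma fps_numeral_compose: "(numeral n :: 'a::comm_ring_1 fps) oo c = numeral n"
  by (simp add: numeral_fps_const)

section \<open>The closed forms\<close>

context
  fixes q v w :: "'a::field_char_0"
  assumes q: "q \<noteq> 0"
begin

private abbreviation (input) "k c \<equiv> kernel_root q oo (fps_const c * fps_X)"
private abbreviation (input) "h c \<equiv> inverse (kernel_root q) oo (fps_const c * fps_X)"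

text \<open>These are the relations at \<open>z = c * x\<close>, used with \<open>c = v\<close> for
  \<open>U_zero\<close> and with \<open>c = v * w\<close> for the other two series.\<close>

lemma kernel_root_compose:
  fixes c
  defines "Z \<equiv> fps_const c * fps_X"
  shows "k c * k c = (1 + Z - 2 * fps_const q * Z) * k c - Z"
    and "t_series q oo Z = 2 * k c - (1 + Z - 2 * fps_const q * Z)"
    and "h c * k c = 1"
    and "(total_fps q oo Z) * (1 + k c) = 2"
    and "k c $ 0 = 1"
proof -
  have Z: "Z $ 0 = 0" by (simp add: Z_def)
  note comp = fps_compose_add_distrib fps_compose_sub_distrib fps_compose_mult_distrib[OF Z]
    fps_numeral_compose
  have "(kernel_root q * kernel_root q) oo Z = ((1 + fps_X - 2 * fps_const q * fps_X) * kernel_root q - fps_X) oo Z"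
    by (simp only: kernel_root_quadratic)
  then show "k c * k c = (1 + Z - 2 * fps_const q * Z) * k c - Z"
    by (simp add: comp Z flip: Z_def)
  show "t_series q oo Z = 2 * k c - (1 + Z - 2 * fps_const q * Z)"
    by (simp add: t_series_eq comp Z flip: Z_def)
  have "(inverse (kernel_root q) * kernel_root q) oo Z = 1 oo Z"
    by (simp only: kernel_root_inverse)
  then show "h c * k c = 1"
    by (simp add: comp Z flip: Z_def)
  have "(total_fps q * (1 + kernel_root q)) oo Z = 2 oo Z"
    by (simp only: total_fps_kernel_root)
  then show "(total_fps q oo Z) * (1 + k c) = 2"
    by (simp add: comp Z flip: Z_def)
  show "k c $ 0 = 1"
    by (simp add: kernel_root_nth_0)
qed

lemma fps_nonzeroI: "f $ 0 \<noteq> 0 \<Longrightarrow> f \<noteq> 0"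
  by auto

lemma U_zero_closed:
  fixes q' v' x :: "'a fps"
  assumes "v \<noteq> 1"
  defines "q' \<equiv> fps_const q" and "v' \<equiv> fps_const v" and "x \<equiv> fps_X"
  shows "U_zero q v =
        (v'*x^2 * (2*(v' - 1)*v'*q'*x - (v' - 3)*v'*x - 3*v' + 1) + v'*(v' + 1)*x^2 * (t_series q oo (v'*x)))
        / (2 * (2*v'*q'*x - v'*x + v' + x - 1) * (v'*q'*x - v'*x - 1))"
proof (rule fps_eq_divideI)
  note K = kernel_root_compose[of v, folded q'_def v'_def x_def]
  let ?k = "kernel_root q oo (v' * x)"
  have "U_zero q v * (1 - x * (inverse (kernel_root q) oo (v' * x))) = v' * x^2 * (total_fps q oo (v' * x))"
    unfolding q'_def v'_def x_def by (rule U_zero_eq[OF inverse_kernel_root_eq q])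
  \<comment> \<open>The factor \<open>?k\<close> clears the reciprocal, and \<open>1 + ?k\<close>
    will clear \<open>total_fps\<close>.\<close>
  moreover have "(?k - x) * (1 + ?k) * U_zero q v
      = ?k * (1 + ?k) * (U_zero q v * (1 - x * (inverse (kernel_root q) oo (v' * x))))"
    using K(3) by algebra
  ultimately have "(?k - x) * (1 + ?k) * U_zero q v = ?k * v' * x^2 * ((total_fps q oo (v' * x)) * (1 + ?k))"
    by (simp add: mult_ac)
  then have "(?k - x) * (1 + ?k) * U_zero q v = 2 * ?k * v' * x^2"
    unfolding K(4) by (simp add: mult_ac)
  moreover have "?k - x \<noteq> 0" "1 + ?k \<noteq> 0"
    by (rule fps_nonzeroI, use K(5) in \<open>simp add: x_def fps_mult_nth_0\<close>)+
  ultimately show "U_zero q v * (2 * (2*v'*q'*x - v'*x + v' + x - 1) * (v'*q'*x - v'*x - 1))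
      = v'*x^2 * (2*(v' - 1)*v'*q'*x - (v' - 3)*v'*x - 3*v' + 1) + v'*(v' + 1)*x^2 * (t_series q oo (v'*x))"
    using eliminate_zero[OF K(1,2) refl] by blast
  show "(2 * (2*v'*q'*x - v'*x + v' + x - 1) * (v'*q'*x - v'*x - 1)) $ 0 \<noteq> 0"
    using \<open>v \<noteq> 1\<close> by (simp add: q'_def v'_def x_def fps_mult_nth_0)
qed

lemma U_plus_closed:
  fixes q' v' w' x :: "'a fps"
  assumes "v \<noteq> 1" "v * w \<noteq> 1"
  defines "q' \<equiv> fps_const q" and "v' \<equiv> fps_const v" and "w' \<equiv> fps_const w" and "x \<equiv> fps_X"
  shows "U_plus q v w =
        - ((v'*w'^2*q'*x^2 * (v'*w'*q'*x - v' + x) * (t_series q oo (v'*w'*x))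
            + v'*w'^2*q'*x^2 * ((2*v'*w'*q'^2 - v'*w'*q' + 1)*v'*w'*x^2
                - (2*v'^2*w'*q' + v'*w'*q' - v'^2*w' + 2*v'*w' + 2*v' - 1)*x + v'))
          / (2 * (2*v'*w'*q'*x - v'*w'*x + v'*w' + x - 1)
            * (v'*w'^2*q'^2*x^2 - v'*w'^2*q'*x^2 - w'*q'*x + v'*w'*x - w'*x - v' + 1)))"
    (is "_ = - (?N / ?D)")
proof -
  have vw: "fps_const (v * w) = v' * w'" by (simp add: v'_def w'_def)
  note K = kernel_root_compose[of "v * w", folded q'_def x_def, unfolded vw]
  let ?k = "kernel_root q oo (v' * w' * x)"
  have "U_plus q v w * ((1 - x * (w' * ((inverse (kernel_root q) oo (v' * w' * x)) + q')))
      * (1 - x * (inverse (kernel_root q) oo (v' * w' * x))))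
    = q' * v' * w'^2 * x^3 * (inverse (kernel_root q) oo (v' * w' * x))"
    using U_plus_eq[OF inverse_kernel_root_eq q, of v w]
    unfolding vw by (simp add: q'_def v'_def w'_def x_def fps_const_power)
  then have "(?k - w' * x * (1 + q' * ?k)) * (?k - x) * U_plus q v w = q' * w' * x^2 * (v' * w' * x) * ?k"
    using K(3) by algebra
  moreover have "?k - x \<noteq> 0" "?k - w' * x * (1 + q' * ?k) \<noteq> 0"
    by (rule fps_nonzeroI, use K(5) in \<open>simp add: x_def fps_mult_nth_0\<close>)+
  ultimately have "U_plus q v w * ?D = - ?N"
    using eliminate_plus[OF K(1,2) refl] by blast
  then have "- U_plus q v w * ?D = ?N"
    by (simp only: mult_minus_left minus_minus)
  moreover have "?D $ 0 \<noteq> 0"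
    using assms(1,2) by (simp add: q'_def v'_def w'_def x_def fps_mult_nth_0)
  ultimately have "- U_plus q v w = ?N / ?D"
    by (rule fps_eq_divideI)
  from arg_cong[OF this, of uminus] show ?thesis
    by (simp only: minus_minus)
qed

lemma U_minus_closed:
  fixes q' v' w' x \<Gamma> \<Delta> :: "'a fps"
  assumes "w \<noteq> 1" "v * w \<noteq> 1"
  defines "q' \<equiv> fps_const q" and "v' \<equiv> fps_const v" and "w' \<equiv> fps_const w" and "x \<equiv> fps_X"
  defines "\<Gamma> \<equiv> 2*v'*w'*q'*x - v'*w'*x + v'*w' + x - 1"
  defines "\<Delta> \<equiv> v'^2*w'*q'^2*x^2 - v'^2*w'*q'*x^2 - v'*q'*x + v'*w'*x - v'*x - w' + 1"
  shows "U_minus q v w =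
        (v'^2*w'*q'*x^2 * (v'*w'*q'*x - v'*w'*x + v'*w' + w' - 1) * (t_series q oo (v'*w'*x))) / (2 * \<Gamma> * \<Delta>)
        + ((- 2*v'*(q' + 1)*x^2 + (v'*q' + 2*v' + 2)*x - 1) * v'^2*w'*q'*x^2)
          / (2 * \<Delta> * (v'*q'*x - 1) * \<Gamma>)
        + ((2*v'^2*q'*(q' - 1)*x^3 - (3*v'*q'^2 - 2*(v' + 1))*v'*x^2
              - (v'^2*q' - 2*v'*q' + 2*(v' + 1)^2)*x + v' + 1) * v'^2*w'^2*q'*x^2)
          / (2 * \<Delta> * (v'*q'*x - 1) * \<Gamma>)
        + ((2*q' - 1) * (v'*q'*x - 1) * (v'*q'*x - v'*x + v' + 1) * v'^3*w'^3*q'*x^3)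
          / (2 * \<Delta> * (v'*q'*x - 1) * \<Gamma>)"
    (is "_ = ?A / _ + ?B / ?D + ?C / ?D + ?E / ?D")
proof -
  have vw: "fps_const (v * w) = v' * w'" by (simp add: v'_def w'_def)
  note K = kernel_root_compose[of "v * w", folded q'_def x_def, unfolded vw]
  let ?k = "kernel_root q oo (v' * w' * x)"
  have "U_minus q v w * ((1 - x * (v' * ((inverse (kernel_root q) oo (v' * w' * x)) + q')))
      * (1 - x * (inverse (kernel_root q) oo (v' * w' * x)))) * (1 - q' * v' * x)
    = q' * v'^2 * w' * x^2 * ((1 - q' * v' * x) - (1 - x * (v' * ((inverse (kernel_root q) oo (v' * w' * x)) + q')))
      * (1 - x * (inverse (kernel_root q) oo (v' * w' * x))))"
    using U_minus_eq[OF inverse_kernel_root_eq q, of v w]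
    unfolding vw by (simp add: q'_def v'_def w'_def x_def fps_const_power)
  then have "(?k - v' * x * (1 + q' * ?k)) * (?k - x) * (1 - q' * v' * x) * U_minus q v w
      = q' * (v' * w' * x) * v' * x * (?k^2 * (1 - q' * v' * x) - (?k - v' * x * (1 + q' * ?k)) * (?k - x))"
    using K(3) by algebra
  moreover have "?k - x \<noteq> 0" "?k - v' * x * (1 + q' * ?k) \<noteq> 0" "1 - q' * v' * x \<noteq> 0"
    by (rule fps_nonzeroI, use K(5) in \<open>simp add: x_def fps_mult_nth_0\<close>)+
  ultimately have "U_minus q v w * ?D = ?A * (v'*q'*x - 1) + ?B + ?C + ?E"
    unfolding \<Gamma>_def \<Delta>_def using eliminate_minus[OF K(1,2) refl] by blast
  moreover have nz: "?D $ 0 \<noteq> 0"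
    using assms(1,2) by (simp add: q'_def v'_def w'_def x_def \<Gamma>_def \<Delta>_def fps_mult_nth_0)
  ultimately have "U_minus q v w = (?A * (v'*q'*x - 1) + ?B + ?C + ?E) / ?D"
    by (rule fps_eq_divideI)
  \<comment> \<open>The first fraction lacks the factor \<open>v' * q' * x - 1\<close> and is
    expanded to the common denominator.\<close>
  moreover have "?A / (2 * \<Gamma> * \<Delta>) = ?A * (v'*q'*x - 1) / ?D"
  proof (rule fps_eq_divideI)
    have "(2 * \<Gamma> * \<Delta>) $ 0 \<noteq> 0" 
      using nz by (simp add: fps_mult_nth_0)
    then have "?A / (2 * \<Gamma> * \<Delta>) * (2 * \<Gamma> * \<Delta>) = ?A"
      by (simp add: fps_divide_unit mult.assoc inverse_mult_eq_1)
    then show "?A / (2 * \<Gamma> * \<Delta>) * ?D = ?A * (v'*q'*x - 1)"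
      by algebra
  qed (rule nz)
  ultimately show ?thesis
    by (simp only: fps_divide_add)
qed

end

theorem theorem3:
  shows "let q = fps_const ind_q; v = fps_const ind_v; w = fps_const ind_w; x = fps_X;
      t = t_series ind_q;
      \<Gamma> = 2*v*w*q*x - v*w*x + v*w + x - 1;
      \<Delta> = v^2*w*q^2*x^2 - v^2*w*q*x^2 - v*q*x + v*w*x - v*x - w + 1
    in
      U_full ind_q ind_v ind_w =
        U_plus ind_q ind_v ind_w + U_minus ind_q ind_v ind_w + U_zero ind_q (ind_v * ind_w)
    \<and> U_zero ind_q ind_v =
        (v*x^2 * (2*(v - 1)*v*q*x - (v - 3)*v*x - 3*v + 1) + v*(v + 1)*x^2 * (t oo (v*x)))
        / (2 * (2*v*q*x - v*x + v + x - 1) * (v*q*x - v*x - 1))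
    \<and> U_plus ind_q ind_v ind_w =
        - ((v*w^2*q*x^2 * (v*w*q*x - v + x) * (t oo (v*w*x))
            + v*w^2*q*x^2 * ((2*v*w*q^2 - v*w*q + 1)*v*w*x^2
                - (2*v^2*w*q + v*w*q - v^2*w + 2*v*w + 2*v - 1)*x + v))
          / (2 * \<Gamma> * (v*w^2*q^2*x^2 - v*w^2*q*x^2 - w*q*x + v*w*x - w*x - v + 1)))
    \<and> U_minus ind_q ind_v ind_w =
        (v^2*w*q*x^2 * (v*w*q*x - v*w*x + v*w + w - 1) * (t oo (v*w*x))) / (2 * \<Gamma> * \<Delta>)
        + ((- 2*v*(q + 1)*x^2 + (v*q + 2*v + 2)*x - 1) * v^2*w*q*x^2)
          / (2 * \<Delta> * (v*q*x - 1) * \<Gamma>)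
        + ((2*v^2*q*(q - 1)*x^3 - (3*v*q^2 - 2*(v + 1))*v*x^2
              - (v^2*q - 2*v*q + 2*(v + 1)^2)*x + v + 1) * v^2*w^2*q*x^2)
          / (2 * \<Delta> * (v*q*x - 1) * \<Gamma>)
        + ((2*q - 1) * (v*q*x - 1) * (v*q*x - v*x + v + 1) * v^3*w^3*q*x^3)
          / (2 * \<Delta> * (v*q*x - 1) * \<Gamma>)"
proof -
  have "ind_q \<noteq> 0"
    by (simp add: ind_q_def Zero_fract_def eq_fract)
  moreover have "ind_v \<noteq> 1" "ind_w \<noteq> 1" "ind_v * ind_w \<noteq> 1"
    using ind_units by auto
  ultimately show ?thesis
    unfolding Let_def
    by (intro conjI U_full_eq U_zero_closed U_plus_closed U_minus_closed)
qed

end
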